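(* Let $\mathcal K$ be $\mathbf{Met}$ or $\mathbf{CMet}$. Every strongly finitary monad $T$ on $\mathcal K$ is (up to isomorphism) the free-algebra monad $T_{\mathcal V}$ for a variety $\mathcal V$ of quantitative algebras (of complete quantitative algebras in case $\mathcal K=\mathbf{CMet}$).
   Context: $\mathbf{Met}$ is the category of extended metric spaces (distance $\infty$ allowed) and nonexpanding maps. $\mathbf{CMet}$ is its full subcategory of complete spaces. Both are enriched over $\mathbf{Met}$ via the supremum metric on hom-sets (tensor product on $\mathbf{Met}$: cartesian product with the sum metric). An endofunctor $F$ is enriched iff $d(Ff,Fg)\le d(f,g)$ for all parallel pairs; an enriched monad is a monad with enriched underlying endofunctor. Let $K:\mathbf{Set}_f\to\mathcal K$ be the full embedding of finite sets as finite discrete spaces (all nonzero distances $\infty$). An enriched endofunctor $T$ on $\mathcal K$ is strongly finitary if it is the enriched left Kan extension along $K$ of its restriction: $T=\mathrm{Lan}_K(TK)$. A monad is strongly finitary if its underlying endofunctor is. Let $\Sigma=(\Sigma_n)_{n\in\mathbb N}$ be a finitary signature. A quantitative algebra is a metric space $A$ with nonexpanding operations $\sigma_A:A^n\to A$ ($\sigma\in\Sigma_n$), where $A^n$ has the maximum metric; it is complete if $A$ is complete. Morphisms are nonexpanding homomorphisms; the categories are denoted $\Sigma$-$\mathbf{Met}$ and $\Sigma$-$\mathbf{CMet}$. A ($1$-basic) quantitative equation is an expression $t=_\varepsilon t'$ with $t,t'$ in the term algebra $T_\Sigma V$ on a finite set $V$ of variables and $\varepsilon\ge 0$ real; $A$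 satisfies it if $d_A(f^{\#}(t),f^{\#}(t'))\le\varepsilon$ for every map $f:V\to A$, where $f^{\#}$ is the homomorphism extending $f$. A variety is a full subcategory of $\Sigma$-$\mathbf{Met}$ (resp. $\Sigma$-$\mathbf{CMet}$), for some $\Sigma$, specified by a set of quantitative equations. The forgetful functor $U_{\mathcal V}$ to $\mathbf{Met}$ (resp. $\mathbf{CMet}$) has a left adjoint $F_{\mathcal V}$; $T_{\mathcal V}=U_{\mathcal V}F_{\mathcal V}$ is the free-algebra monad. *)

theory Defs
  imports "HOL-Library.Extended_Nonnegative_Real" "HOL-Library.FuncSet"
begin

section \<open>The categories of extended metric spaces\<close>

text \<open>
  A set universe is given by a type \<open>'u\<close> and the collection \<open>\<U>\<close> of its small subsets. Only the
  closure properties below are imposed. They hold for the members of any Grothendieck universe,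
  with \<open>'u\<close> its type of elements.
\<close>

definition set_universe :: "'u set set \<Rightarrow> bool" where
  "set_universe \<U> \<longleftrightarrow>
     infinite (UNIV :: 'u set) \<and>
     (\<forall>A. finite A \<longrightarrow> A \<in> \<U>) \<and>
     (\<forall>A B. A \<subseteq> B \<longrightarrow> B \<in> \<U> \<longrightarrow> A \<in> \<U>)"

record 'u espace =
  pts :: "'u set"
  dst :: "'u \<Rightarrow> 'u \<Rightarrow> ennreal"

text \<open>
  The normalization of \<open>dst\<close> outside the carrier makes equality of records the same as equality of
  spaces.
\<close>

definition ext_metric_space :: "'u espace \<Rightarrow> bool" where
  "ext_metric_space X \<longleftrightarrow>
     (\<forall>x\<in>pts X. \<forall>y\<in>pts X. dst X x y = 0 \<longleftrightarrow> x = y) \<and>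
     (\<forall>x\<in>pts X. \<forall>y\<in>pts X. dst X x y = dst X y x) \<and>
     (\<forall>x\<in>pts X. \<forall>y\<in>pts X. \<forall>z\<in>pts X. dst X x z \<le> dst X x y + dst X y z) \<and>
     (\<forall>x y. x \<notin> pts X \<or> y \<notin> pts X \<longrightarrow> dst X x y = 0)"

definition complete_space :: "'u espace \<Rightarrow> bool" where
  "complete_space X \<longleftrightarrow>
     (\<forall>s :: nat \<Rightarrow> 'u.
        (\<forall>n. s n \<in> pts X) \<and> (\<forall>e>0. \<exists>N. \<forall>m\<ge>N. \<forall>n\<ge>N. dst X (s m) (s n) < e) \<longrightarrow>
        (\<exists>l\<in>pts X. \<forall>e>0. \<exists>N. \<forall>n\<ge>N. dst X (s n) l < e))"

definition hom :: "'u espace \<Rightarrow> 'u espace \<Rightarrow> ('u \<Rightarrow> 'u) set" where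
  "hom X Y =
     {f \<in> pts X \<rightarrow>\<^sub>E pts Y. \<forall>x\<in>pts X. \<forall>y\<in>pts X. dst Y (f x) (f y) \<le> dst X x y}"

definition ident :: "'u espace \<Rightarrow> 'u \<Rightarrow> 'u" where
  "ident X = restrict (\<lambda>x. x) (pts X)"

definition hdist :: "'u espace \<Rightarrow> 'u espace \<Rightarrow> ('u \<Rightarrow> 'u) \<Rightarrow> ('u \<Rightarrow> 'u) \<Rightarrow> ennreal" where
  "hdist X Y f g = (SUP x\<in>pts X. dst Y (f x) (g x))"

text \<open>
  All categories of spaces used here are full subcategories of the category of extended metric
  spaces. They are represented by their sets of objects.
\<close>

definition Met :: "'u set set \<Rightarrow> 'u espace set" where
  "Met \<U> = {X. ext_metric_space X \<and> pts X \<in> \<U>}"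

definition CMet :: "'u set set \<Rightarrow> 'u espace set" where
  "CMet \<U> = {X \<in> Met \<U>. complete_space X}"

definition Set_f :: "'u espace set" where
  "Set_f = {X. ext_metric_space X \<and> finite (pts X) \<and>
              (\<forall>x\<in>pts X. \<forall>y\<in>pts X. x \<noteq> y \<longrightarrow> dst X x y = \<infinity>)}"


section \<open>Enriched functors, Kan extensions and monads\<close>

record 'u efunctor =
  Ob :: "'u espace \<Rightarrow> 'u espace"
  Ar :: "'u espace \<Rightarrow> 'u espace \<Rightarrow> ('u \<Rightarrow> 'u) \<Rightarrow> ('u \<Rightarrow> 'u)"

definition enriched_functor :: "'u espace set \<Rightarrow> 'u espace set \<Rightarrow> 'u efunctor \<Rightarrow> bool" where
  "enriched_functor \<A> \<C> F \<longleftrightarrow>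
     (\<forall>X\<in>\<A>. Ob F X \<in> \<C>) \<and>
     (\<forall>X\<in>\<A>. \<forall>Y\<in>\<A>. \<forall>f\<in>hom X Y. Ar F X Y f \<in> hom (Ob F X) (Ob F Y)) \<and>
     (\<forall>X\<in>\<A>. Ar F X X (ident X) = ident (Ob F X)) \<and>
     (\<forall>X\<in>\<A>. \<forall>Y\<in>\<A>. \<forall>Z\<in>\<A>. \<forall>f\<in>hom X Y. \<forall>g\<in>hom Y Z.
        Ar F X Z (compose (pts X) g f) =
          compose (pts (Ob F X)) (Ar F Y Z g) (Ar F X Y f)) \<and>
     (\<forall>X\<in>\<A>. \<forall>Y\<in>\<A>. \<forall>f\<in>hom X Y. \<forall>g\<in>hom X Y.
        hdist (Ob F X) (Ob F Y) (Ar F X Y f) (Ar F X Y g) \<le> hdist X Y f g)"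

text \<open>
  Enriched naturality is ordinary naturality, because the enriching category is concrete.
\<close>

definition nat_trans ::
    "'u espace set \<Rightarrow> 'u efunctor \<Rightarrow> 'u efunctor \<Rightarrow> ('u espace \<Rightarrow> 'u \<Rightarrow> 'u) \<Rightarrow> bool" where
  "nat_trans \<A> F G \<theta> \<longleftrightarrow>
     (\<forall>X\<in>\<A>. \<theta> X \<in> hom (Ob F X) (Ob G X)) \<and>
     (\<forall>X\<in>\<A>. \<forall>Y\<in>\<A>. \<forall>f\<in>hom X Y.
        compose (pts (Ob F X)) (\<theta> Y) (Ar F X Y f) =
        compose (pts (Ob F X)) (Ar G X Y f) (\<theta> X))"

text \<open>
  Let \<open>K\<close> be the inclusion of the full subcategory \<open>\<A>\<close> of \<open>\<C>\<close>, and \<open>G\<close> a functor from \<open>\<A>\<close> to \<open>\<C>\<close>.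
  A \<open>K(-,X)\<close>-weighted cocone of \<open>G\<close> with vertex \<open>Y\<close> is a morphism from \<open>\<C>(K-,X)\<close> to \<open>\<C>(G-,Y)\<close>
  between enriched presheaves on \<open>\<A>\<close>.
\<close>

definition weighted_cocone ::
    "'u espace set \<Rightarrow> 'u efunctor \<Rightarrow> 'u espace \<Rightarrow> 'u espace \<Rightarrow>
       ('u espace \<Rightarrow> ('u \<Rightarrow> 'u) \<Rightarrow> ('u \<Rightarrow> 'u)) \<Rightarrow> bool" where
  "weighted_cocone \<A> G X Y \<alpha> \<longleftrightarrow>
     (\<forall>N\<in>\<A>. \<forall>f\<in>hom N X. \<alpha> N f \<in> hom (Ob G N) Y) \<and>
     (\<forall>N\<in>\<A>. \<forall>f\<in>hom N X. \<forall>g\<in>hom N X.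
        hdist (Ob G N) Y (\<alpha> N f) (\<alpha> N g) \<le> hdist N X f g) \<and>
     (\<forall>M\<in>\<A>. \<forall>N\<in>\<A>. \<forall>h\<in>hom M N. \<forall>f\<in>hom N X.
        \<alpha> M (compose (pts M) f h) = compose (pts (Ob G M)) (\<alpha> N f) (Ar G M N h))"

definition induced_cocone ::
    "'u efunctor \<Rightarrow> 'u efunctor \<Rightarrow> ('u espace \<Rightarrow> 'u \<Rightarrow> 'u) \<Rightarrow> 'u espace \<Rightarrow>
       ('u \<Rightarrow> 'u) \<Rightarrow> 'u espace \<Rightarrow> ('u \<Rightarrow> 'u) \<Rightarrow> ('u \<Rightarrow> 'u)" where
  "induced_cocone G L \<theta> X g N f =
     compose (pts (Ob G N)) g (compose (pts (Ob G N)) (Ar L N X f) (\<theta> N))"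

text \<open>
  The enriched (hence pointwise) left Kan extension \<open>L\<close> of \<open>G\<close> along \<open>K\<close>, with unit \<open>\<theta>\<close> from \<open>G\<close> to
  \<open>LK\<close>: each \<open>LX\<close> is the colimit of \<open>G\<close> weighted by \<open>\<C>(K-,X)\<close>. So the passage from \<open>g : LX \<rightarrow> Y\<close> to
  the induced cocone is an isomorphism in the enriching category, that is, a bijection (first
  conjunct under the quantifiers) that preserves distances (second conjunct).
\<close>

definition is_left_Kan_extension ::
    "'u espace set \<Rightarrow> 'u espace set \<Rightarrow> 'u efunctor \<Rightarrow> 'u efunctor \<Rightarrow>
       ('u espace \<Rightarrow> 'u \<Rightarrow> 'u) \<Rightarrow> bool" where
  "is_left_Kan_extension \<A> \<C> G L \<theta> \<longleftrightarrow>
     enriched_functor \<A> \<C> G \<and> enriched_functor \<C> \<C> L \<and> nat_trans \<A> G L \<theta> \<and>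
     (\<forall>X\<in>\<C>. \<forall>Y\<in>\<C>.
        (\<forall>\<alpha>. weighted_cocone \<A> G X Y \<alpha> \<longrightarrow>
           (\<exists>!g. g \<in> hom (Ob L X) Y \<and>
              (\<forall>N\<in>\<A>. \<forall>f\<in>hom N X. \<alpha> N f = induced_cocone G L \<theta> X g N f))) \<and>
        (\<forall>g\<in>hom (Ob L X) Y. \<forall>g'\<in>hom (Ob L X) Y.
           hdist (Ob L X) Y g g' =
             (SUP N\<in>\<A>. SUP f\<in>hom N X.
                hdist (Ob G N) Y (induced_cocone G L \<theta> X g N f)
                  (induced_cocone G L \<theta> X g' N f))))"

text \<open>
  The restriction of \<open>T\<close> along the inclusion of \<open>Set_f\<close> is \<open>T\<close> itself, used only on objects and
  morphisms of \<open>Set_f\<close>.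
\<close>

definition strongly_finitary :: "'u espace set \<Rightarrow> 'u efunctor \<Rightarrow> bool" where
  "strongly_finitary \<C> T \<longleftrightarrow>
     is_left_Kan_extension Set_f \<C> T T (\<lambda>N. ident (Ob T N))"

definition id_functor :: "'u efunctor" where
  "id_functor = \<lparr>Ob = (\<lambda>X. X), Ar = (\<lambda>X Y f. f)\<rparr>"

definition comp_functor :: "'u efunctor \<Rightarrow> 'u efunctor \<Rightarrow> 'u efunctor" where
  "comp_functor G F =
     \<lparr>Ob = (\<lambda>X. Ob G (Ob F X)), Ar = (\<lambda>X Y f. Ar G (Ob F X) (Ob F Y) (Ar F X Y f))\<rparr>"

record 'u monad =
  functor_of :: "'u efunctor"
  unit_at :: "'u espace \<Rightarrow> 'u \<Rightarrow> 'u"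
  mult_at :: "'u espace \<Rightarrow> 'u \<Rightarrow> 'u"

definition enriched_monad :: "'u espace set \<Rightarrow> 'u monad \<Rightarrow> bool" where
  "enriched_monad \<C> T \<longleftrightarrow>
     enriched_functor \<C> \<C> (functor_of T) \<and>
     nat_trans \<C> id_functor (functor_of T) (unit_at T) \<and>
     nat_trans \<C> (comp_functor (functor_of T) (functor_of T)) (functor_of T) (mult_at T) \<and>
     (\<forall>X\<in>\<C>. let TX = Ob (functor_of T) X; TTX = Ob (functor_of T) TX; TTTX = Ob (functor_of T) TTX in
        compose (pts TX) (mult_at T X) (unit_at T TX) = ident TX \<and>
        compose (pts TX) (mult_at T X) (Ar (functor_of T) X TX (unit_at T X)) = ident TX \<and>
        compose (pts TTTX) (mult_at T X) (mult_at T TX) =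
          compose (pts TTTX) (mult_at T X) (Ar (functor_of T) TTX TX (mult_at T X)))"

definition strongly_finitary_monad :: "'u espace set \<Rightarrow> 'u monad \<Rightarrow> bool" where
  "strongly_finitary_monad \<C> T \<longleftrightarrow> enriched_monad \<C> T \<and> strongly_finitary \<C> (functor_of T)"

definition iso_hom :: "'u espace \<Rightarrow> 'u espace \<Rightarrow> ('u \<Rightarrow> 'u) \<Rightarrow> bool" where
  "iso_hom X Y f \<longleftrightarrow> f \<in> hom X Y \<and>
     (\<exists>g\<in>hom Y X. compose (pts X) g f = ident X \<and> compose (pts Y) f g = ident Y)"

definition monads_isomorphic :: "'u espace set \<Rightarrow> 'u monad \<Rightarrow> 'u monad \<Rightarrow> bool" where
  "monads_isomorphic \<C> S T \<longleftrightarrow>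
     (\<exists>\<iota>. nat_trans \<C> (functor_of S) (functor_of T) \<iota> \<and>
        (\<forall>X\<in>\<C>. let SX = Ob (functor_of S) X; TX = Ob (functor_of T) X; SSX = Ob (functor_of S) SX in
           iso_hom SX TX (\<iota> X) \<and>
           compose (pts X) (\<iota> X) (unit_at S X) = unit_at T X \<and>
           compose (pts SSX) (\<iota> X) (mult_at S X) =
             compose (pts SSX) (mult_at T X)
               (compose (pts SSX) (\<iota> TX) (Ar (functor_of S) SX TX (\<iota> X)))))"


section \<open>Quantitative algebras and varieties\<close>

text \<open>
  A signature is a family of sets of operation symbols indexed by arities. The sets need not be
  disjoint: the arity of an occurrence of a symbol is the length of its argument list.
\<close>

type_synonym 'f signature = "nat \<Rightarrow> 'f set"

record ('f, 'u) algebra =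
  under :: "'u espace"
  opn :: "'f \<Rightarrow> 'u list \<Rightarrow> 'u"

definition quantitative_algebra ::
    "'u espace set \<Rightarrow> 'f signature \<Rightarrow> ('f, 'u) algebra \<Rightarrow> bool" where
  "quantitative_algebra \<C> \<Sigma> A \<longleftrightarrow>
     under A \<in> \<C> \<and>
     (\<forall>n. \<forall>\<sigma>\<in>\<Sigma> n. \<forall>xs\<in>lists (pts (under A)). length xs = n \<longrightarrow>
        opn A \<sigma> xs \<in> pts (under A)) \<and>
     (\<forall>n. \<forall>\<sigma>\<in>\<Sigma> n. \<forall>xs\<in>lists (pts (under A)). \<forall>ys\<in>lists (pts (under A)).
        length xs = n \<longrightarrow> length ys = n \<longrightarrow>
        dst (under A) (opn A \<sigma> xs) (opn A \<sigma> ys) \<le> (SUP i\<in>{..<n}. dst (under A) (xs ! i) (ys ! i)))"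

definition alg_hom ::
    "'f signature \<Rightarrow> ('f, 'u) algebra \<Rightarrow> ('f, 'u) algebra \<Rightarrow> ('u \<Rightarrow> 'u) set" where
  "alg_hom \<Sigma> A B =
     {h \<in> hom (under A) (under B).
        \<forall>n. \<forall>\<sigma>\<in>\<Sigma> n. \<forall>xs\<in>lists (pts (under A)). length xs = n \<longrightarrow>
          h (opn A \<sigma> xs) = opn B \<sigma> (map h xs)}"

datatype ('f, 'v) trm = Var 'v | App 'f "('f, 'v) trm list"

inductive_set terms :: "'f signature \<Rightarrow> 'v set \<Rightarrow> ('f, 'v) trm set"
  for \<Sigma> :: "'f signature" and V :: "'v set" where
  Var: "x \<in> V \<Longrightarrow> Var x \<in> terms \<Sigma> V"
| App: "\<lbrakk>\<sigma> \<in> \<Sigma> (length ts); \<And>t. t \<in> set ts \<Longrightarrow> t \<in> terms \<Sigma> V\<rbrakk> \<Longrightarrow> App \<sigma> ts \<in> terms \<Sigma> V"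

primrec eval :: "('f, 'u) algebra \<Rightarrow> ('v \<Rightarrow> 'u) \<Rightarrow> ('f, 'v) trm \<Rightarrow> 'u" where
  "eval A f (Var x) = f x"
| "eval A f (App \<sigma> ts) = opn A \<sigma> (map (eval A f) ts)"

text \<open>
  The variable set is part of an equation, since variables that do not occur in the two terms
  matter for satisfaction in an empty algebra.
\<close>

record 'f quantitative_equation =
  vars :: "nat set"
  lhs :: "('f, nat) trm"
  rhs :: "('f, nat) trm"
  bound :: real

definition equation_over :: "'f signature \<Rightarrow> 'f quantitative_equation \<Rightarrow> bool" where
  "equation_over \<Sigma> e \<longleftrightarrow>
     finite (vars e) \<and> lhs e \<in> terms \<Sigma> (vars e) \<and> rhs e \<in> terms \<Sigma> (vars e) \<and> bound e \<ge> 0"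

definition satisfies :: "('f, 'u) algebra \<Rightarrow> 'f quantitative_equation \<Rightarrow> bool" where
  "satisfies A e \<longleftrightarrow>
     (\<forall>f\<in>vars e \<rightarrow> pts (under A).
        dst (under A) (eval A f (lhs e)) (eval A f (rhs e)) \<le> ennreal (bound e))"

definition variety ::
    "'u espace set \<Rightarrow> 'f signature \<Rightarrow> 'f quantitative_equation set \<Rightarrow> ('f, 'u) algebra set" where
  "variety \<C> \<Sigma> E = {A. quantitative_algebra \<C> \<Sigma> A \<and> (\<forall>e\<in>E. satisfies A e)}"


section \<open>Free-algebra monads\<close>

definition is_free_algebra ::
    "'f signature \<Rightarrow> ('f, 'u) algebra set \<Rightarrow> 'u espace \<Rightarrow> ('f, 'u) algebra \<Rightarrow> ('u \<Rightarrow> 'u) \<Rightarrow> bool" where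
  "is_free_algebra \<Sigma> \<V> X F \<eta> \<longleftrightarrow>
     F \<in> \<V> \<and> \<eta> \<in> hom X (under F) \<and>
     (\<forall>A\<in>\<V>. \<forall>f\<in>hom X (under A).
        \<exists>!h. h \<in> alg_hom \<Sigma> F A \<and> compose (pts X) h \<eta> = f)"

text \<open>
  The monad induced by a left adjoint to the forgetful functor of \<open>\<V>\<close>, as the left adjoint is
  unique only up to isomorphism. The adjoint is given by free algebras \<open>F X\<close> with universal arrows
  \<open>\<eta>\<^sub>X\<close>. It acts on \<open>f : X \<rightarrow> Y\<close> by the unique homomorphism extending \<open>\<eta>\<^sub>Y \<circ> f\<close>, and its counit
  at \<open>F X\<close>, which is the multiplication, is the unique homomorphism extending the identity.
\<close>

definition is_free_algebra_monad ::
    "'u espace set \<Rightarrow> 'f signature \<Rightarrow> ('f, 'u) algebra set \<Rightarrow> 'u monad \<Rightarrow> bool" where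
  "is_free_algebra_monad \<C> \<Sigma> \<V> M \<longleftrightarrow>
     (\<exists>F :: 'u espace \<Rightarrow> ('f, 'u) algebra.
        (\<forall>X\<in>\<C>. is_free_algebra \<Sigma> \<V> X (F X) (unit_at M X) \<and> Ob (functor_of M) X = under (F X)) \<and>
        (\<forall>X\<in>\<C>. \<forall>Y\<in>\<C>. \<forall>f\<in>hom X Y.
           Ar (functor_of M) X Y f \<in> alg_hom \<Sigma> (F X) (F Y) \<and>
           compose (pts X) (Ar (functor_of M) X Y f) (unit_at M X) = compose (pts X) (unit_at M Y) f) \<and>
        (\<forall>X\<in>\<C>. let TX = under (F X) in
           mult_at M X \<in> alg_hom \<Sigma> (F TX) (F X) \<and>
           compose (pts TX) (mult_at M X) (unit_at M TX) = ident TX))"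

end

theory Submission
  imports Defs
begin

text \<open>
  The variety is the one whose \<open>n\<close>-ary operation symbols are the elements of \<open>T n\<close>. They act on
  every \<open>T X\<close> by substitution, \<open>\<sigma>(x) = \<mu> (T x \<sigma>)\<close>, and the equations are all those valid in these
  algebras \<open>T X\<close>. Then \<open>T X\<close> itself, with the unit of \<open>T\<close>, is free on \<open>X\<close>. A map \<open>f : X \<rightarrow> A\<close> into an
  algebra of the variety turns each \<open>g : n \<rightarrow> X\<close> into the map \<open>t \<mapsto> t\<^sub>A (f \<circ> g)\<close> from \<open>T n\<close> to \<open>A\<close>. These
  maps form a weighted cocone, so they factor uniquely through \<open>T X\<close> since \<open>T\<close> is strongly
  finitary. The factorization is a homomorphism on elements that come from some \<open>T n\<close>, and such
  elements are dense in \<open>T X\<close>.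
\<close>

section \<open>Extended metric spaces\<close>

lemma ext_metricD:
  assumes "ext_metric_space X"
  shows "x \<in> pts X \<Longrightarrow> dst X x x = 0"
    and "x \<in> pts X \<Longrightarrow> y \<in> pts X \<Longrightarrow> dst X x y = 0 \<Longrightarrow> x = y"
    and "x \<in> pts X \<Longrightarrow> y \<in> pts X \<Longrightarrow> dst X x y = dst X y x"
    and "x \<in> pts X \<Longrightarrow> y \<in> pts X \<Longrightarrow> z \<in> pts X \<Longrightarrow> dst X x z \<le> dst X x y + dst X y z"
  using assms unfolding ext_metric_space_def by blast+

lemma hom_mem: "f \<in> hom X Y \<Longrightarrow> x \<in> pts X \<Longrightarrow> f x \<in> pts Y"
  unfolding hom_def by auto

lemma hom_dst: "f \<in> hom X Y \<Longrightarrow> x \<in> pts X \<Longrightarrow> y \<in> pts X \<Longrightarrow> dst Y (f x) (f y) \<le> dst X x y"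
  unfolding hom_def by auto

lemma hom_extensional: "f \<in> hom X Y \<Longrightarrow> f \<in> extensional (pts X)"
  unfolding hom_def by (auto simp: PiE_def)

lemma homI:
  assumes "f \<in> extensional (pts X)" "\<And>x. x \<in> pts X \<Longrightarrow> f x \<in> pts Y"
    and "\<And>x y. x \<in> pts X \<Longrightarrow> y \<in> pts X \<Longrightarrow> dst Y (f x) (f y) \<le> dst X x y"
  shows "f \<in> hom X Y"
  using assms unfolding hom_def by (auto simp: PiE_def)

lemma ident_hom: "ident X \<in> hom X X"
  by (rule homI) (auto simp: ident_def)

lemma compose_hom:
  assumes "f \<in> hom X Y" "g \<in> hom Y Z"
  shows "compose (pts X) g f \<in> hom X Z"
  using hom_mem[OF assms(1)] hom_mem[OF assms(2)]
    order_trans[OF hom_dst[OF assms(2)] hom_dst[OF assms(1)]]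
  by (intro homI) (auto simp: compose_def)

lemma compose_ident: "f \<in> hom X Y \<Longrightarrow> compose (pts X) (ident Y) f = f"
  by (rule extensionalityI[of _ "pts X"])
    (auto simp: compose_def ident_def hom_mem hom_extensional)

text \<open>Infinite \<open>\<delta>\<close> is covered too: the half is then infinite as
  well.\<close>

lemma ennreal_half:
  fixes \<delta> :: ennreal
  assumes "\<delta> > 0"
  obtains e where "e > 0" "e + e = \<delta>"
proof (rule that)
  show "\<delta> / 2 > 0" using assms by (simp add: ennreal_zero_less_divide)
  show "\<delta> / 2 + \<delta> / 2 = \<delta>"
    by (simp add: mult_2[symmetric] ennreal_times_divide ennreal_mult_divide_eq mult.commute[of 2])
qed

section \<open>Subspaces and finite discrete spaces\<close>

definition subspace :: "'u espace \<Rightarrow> 'u set \<Rightarrow> 'u espace" where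
  "subspace X C = \<lparr>pts = C, dst = (\<lambda>x y. if x \<in> C \<and> y \<in> C then dst X x y else 0)\<rparr>"

lemma ext_metric_subspace:
  assumes "ext_metric_space X" "C \<subseteq> pts X"
  shows "ext_metric_space (subspace X C)"
proof -
  have C: "\<And>x. x \<in> C \<Longrightarrow> x \<in> pts X" using assms(2) by auto
  show ?thesis
    unfolding ext_metric_space_def subspace_def
    using ext_metricD[OF assms(1)] by (auto dest!: C) 
qed

definition disc :: "'u set \<Rightarrow> 'u espace" where
  "disc S = \<lparr>pts = S, dst = (\<lambda>x y. if x \<in> S \<and> y \<in> S \<and> x \<noteq> y then \<infinity> else 0)\<rparr>"

lemma pts_disc [simp]: "pts (disc S) = S"
  by (simp add: disc_def)

lemma disc_in_Set_f: "finite S \<Longrightarrow> disc S \<in> Set_f"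
  unfolding Set_f_def ext_metric_space_def disc_def by auto

text \<open>Distinct points of \<open>N\<close> are infinitely far apart, so nonexpansiveness only
  has to be checked at equal points, where both distances vanish.\<close>

lemma hom_from_Set_f:
  assumes "N \<in> Set_f" "ext_metric_space X" "f \<in> extensional (pts N)"
    "\<And>x. x \<in> pts N \<Longrightarrow> f x \<in> pts X"
  shows "f \<in> hom N X"
proof (rule homI[OF assms(3,4)])
  fix x y assume "x \<in> pts N" "y \<in> pts N"
  then show "dst X (f x) (f y) \<le> dst N x y"
    using assms ext_metricD(1)[OF assms(2)] by (cases "x = y") (auto simp: Set_f_def)
qed

text \<open>A Cauchy sequence is eventually constant: terms at distance below 1 must
  coincide.\<close>

lemma Set_f_complete:
  assumes "N \<in> Set_f"
  shows "complete_space N"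
  unfolding complete_space_def
proof (intro allI impI, elim conjE)
  fix s :: "nat \<Rightarrow> 'a"
  assume s: "\<forall>n. s n \<in> pts N" and cauchy: "\<forall>e>0. \<exists>M. \<forall>m\<ge>M. \<forall>n\<ge>M. dst N (s m) (s n) < e"
  have "(1::ennreal) > 0" by simp
  then obtain M where M: "\<forall>m\<ge>M. \<forall>n\<ge>M. dst N (s m) (s n) < 1"
    using cauchy by metis
  have "dst N (s n) (s M) = 0" if "n \<ge> M" for n
  proof -
    have "s n = s M"
      using M that s assms unfolding Set_f_def by (force simp: not_less)
    then show ?thesis
      using assms s ext_metricD(1) unfolding Set_f_def by force
  qed
  then show "\<exists>l\<in>pts N. \<forall>e>0. \<exists>M. \<forall>n\<ge>M. dst N (s n) l < e"
    using s by (intro bexI[of _ "s M"]) (auto intro!: exI[of _ M])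
qed

text \<open>Smallness is inherited because \<open>\<U>\<close> is closed under subsets, and
  completeness because \<open>closed\<close> puts the limit in \<open>X\<close> of a sequence from
  \<open>C\<close> back into \<open>C\<close>. The closure of a set of elements of T X thereby
  becomes an admissible vertex of cocones in both categories.\<close>

lemma subspace_in_category:
  assumes "set_universe \<U>" "\<K> = Met \<U> \<or> \<K> = CMet \<U>" "X \<in> \<K>" "C \<subseteq> pts X"
    and closed: "\<And>l. l \<in> pts X \<Longrightarrow> (\<And>e. e > 0 \<Longrightarrow> \<exists>c\<in>C. dst X c l < e) \<Longrightarrow> l \<in> C"
  shows "subspace X C \<in> \<K>"
proof -
  have X: "ext_metric_space X" "pts X \<in> \<U>"
    using assms(2,3) by (auto simp: CMet_def Met_def)
  have "C \<in> \<U>"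
    using assms(1,4) X(2) unfolding set_universe_def by blast
  then have met: "subspace X C \<in> Met \<U>"
    using ext_metric_subspace[OF X(1) assms(4)] by (simp add: Met_def subspace_def)
  have "complete_space (subspace X C)" if complete: "complete_space X"
    unfolding complete_space_def
  proof (intro allI impI, elim conjE)
    fix s :: "nat \<Rightarrow> 'a"
    assume s: "\<forall>n. s n \<in> pts (subspace X C)"
      and cauchy: "\<forall>e>0. \<exists>M. \<forall>m\<ge>M. \<forall>n\<ge>M. dst (subspace X C) (s m) (s n) < e"
    have sC: "s n \<in> C" for n using s by (simp add: subspace_def)
    have "\<forall>e>0. \<exists>M. \<forall>m\<ge>M. \<forall>n\<ge>M. dst X (s m) (s n) < e"
      using cauchy sC by (simp add: subspace_def)
    moreover have "\<forall>n. s n \<in> pts X" using sC assms(4) by auto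
    ultimately obtain l where l: "l \<in> pts X" "\<forall>e>0. \<exists>M. \<forall>n\<ge>M. dst X (s n) l < e"
      using spec[OF complete[unfolded complete_space_def], of s] by blast
    have "l \<in> C"
      using l sC by (intro closed) (meson order_refl)+
    then show "\<exists>l\<in>pts (subspace X C). \<forall>e>0. \<exists>M. \<forall>n\<ge>M. dst (subspace X C) (s n) l < e"
      using l sC by (intro bexI[of _ l]) (auto simp: subspace_def)
  qed
  then show ?thesis
    using met assms(2,3) by (auto simp: CMet_def)
qed

lemma Set_f_subset_category:
  assumes "set_universe \<U>" "\<K> = Met \<U> \<or> \<K> = CMet \<U>"
  shows "Set_f \<subseteq> \<K>"
proof
  fix N :: "'a espace" assume N: "N \<in> Set_f"
  then have "ext_metric_space N" "pts N \<in> \<U>"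
    using assms(1) by (auto simp: Set_f_def set_universe_def)
  then show "N \<in> \<K>"
    using assms(2) Set_f_complete[OF N] by (auto simp: Met_def CMet_def)
qed


section \<open>The algebras of a strongly finitary monad\<close>

text \<open>The injection \<open>pt\<close> supplies the points of one standard n-element space
  inside the universe type for every n.\<close>

locale space_monad =
  fixes \<U> :: "'u set set" and \<K> :: "'u espace set" and T :: "'u monad" and pt :: "nat \<Rightarrow> 'u"
  assumes universe: "set_universe \<U>"
    and base: "\<K> = Met \<U> \<or> \<K> = CMet \<U>"
    and monad: "strongly_finitary_monad \<K> T"
    and inj_pt: "inj pt"
begin

abbreviation TO :: "'u espace \<Rightarrow> 'u espace" where "TO \<equiv> Ob (functor_of T)"
abbreviation TA :: "'u espace \<Rightarrow> 'u espace \<Rightarrow> ('u \<Rightarrow> 'u) \<Rightarrow> 'u \<Rightarrow> 'u" where "TA \<equiv> Ar (functor_of T)"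
abbreviation unit :: "'u espace \<Rightarrow> 'u \<Rightarrow> 'u" where "unit \<equiv> unit_at T"
abbreviation mult :: "'u espace \<Rightarrow> 'u \<Rightarrow> 'u" where "mult \<equiv> mult_at T"

section \<open>Pointwise form of the functor and monad laws\<close>

lemma in_metric: "X \<in> \<K> \<Longrightarrow> ext_metric_space X"
  using base by (auto simp: CMet_def Met_def)

lemma in_universe: "X \<in> \<K> \<Longrightarrow> pts X \<in> \<U>"
  using base by (auto simp: CMet_def Met_def)

lemma Set_f_in: "N \<in> Set_f \<Longrightarrow> N \<in> \<K>"
  using Set_f_subset_category[OF universe base] by auto

lemma enriched: "enriched_functor \<K> \<K> (functor_of T)"
  and unit_nat: "nat_trans \<K> id_functor (functor_of T) unit"
  and mult_nat: "nat_trans \<K> (comp_functor (functor_of T) (functor_of T)) (functor_of T) mult"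
  and monad_laws: "\<And>X. X \<in> \<K> \<Longrightarrow>
        compose (pts (TO X)) (mult X) (unit (TO X)) = ident (TO X) \<and>
        compose (pts (TO X)) (mult X) (TA X (TO X) (unit X)) = ident (TO X) \<and>
        compose (pts (TO (TO (TO X)))) (mult X) (mult (TO X)) =
          compose (pts (TO (TO (TO X)))) (mult X) (TA (TO (TO X)) (TO X) (mult X))"
  and kan: "is_left_Kan_extension Set_f \<K> (functor_of T) (functor_of T) (\<lambda>N. ident (TO N))"
  using monad unfolding strongly_finitary_monad_def strongly_finitary_def enriched_monad_def
  by (auto simp: Let_def)

lemma TO_in: "X \<in> \<K> \<Longrightarrow> TO X \<in> \<K>"
  using enriched unfolding enriched_functor_def by blast

lemma TA_hom: "X \<in> \<K> \<Longrightarrow> Y \<in> \<K> \<Longrightarrow> f \<in> hom X Y \<Longrightarrow> TA X Y f \<in> hom (TO X) (TO Y)"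
  using enriched unfolding enriched_functor_def by blast

lemma TA_ident: "X \<in> \<K> \<Longrightarrow> TA X X (ident X) = ident (TO X)"
  using enriched unfolding enriched_functor_def by blast

lemma TA_compose:
  assumes "X \<in> \<K>" "Y \<in> \<K>" "Z \<in> \<K>" "f \<in> hom X Y" "g \<in> hom Y Z"
  shows "TA X Z (compose (pts X) g f) = compose (pts (TO X)) (TA Y Z g) (TA X Y f)"
  using assms enriched unfolding enriched_functor_def by blast

lemma TA_TA:
  assumes "X \<in> \<K>" "Y \<in> \<K>" "Z \<in> \<K>" "f \<in> hom X Y" "g \<in> hom Y Z" "x \<in> pts (TO X)"
  shows "TA Y Z g (TA X Y f x) = TA X Z (compose (pts X) g f) x"
  using TA_compose[OF assms(1-5)] assms(6) by (simp add: compose_def)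

lemma TA_hdist:
  assumes "X \<in> \<K>" "Y \<in> \<K>" "f \<in> hom X Y" "g \<in> hom X Y"
  shows "hdist (TO X) (TO Y) (TA X Y f) (TA X Y g) \<le> hdist X Y f g"
  using assms enriched unfolding enriched_functor_def by blast

lemma unit_hom: "X \<in> \<K> \<Longrightarrow> unit X \<in> hom X (TO X)"
  using unit_nat unfolding nat_trans_def by (auto simp: id_functor_def)

lemma TA_unit:
  assumes "X \<in> \<K>" "Y \<in> \<K>" "f \<in> hom X Y"
  shows "compose (pts X) (TA X Y f) (unit X) = compose (pts X) (unit Y) f"
  using unit_nat assms unfolding nat_trans_def by (auto simp: id_functor_def)

lemma mult_hom: "X \<in> \<K> \<Longrightarrow> mult X \<in> hom (TO (TO X)) (TO X)"
  using mult_nat unfolding nat_trans_def by (auto simp: comp_functor_def)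

lemma TA_mult:
  assumes "X \<in> \<K>" "Y \<in> \<K>" "f \<in> hom X Y" "x \<in> pts (TO (TO X))"
  shows "TA X Y f (mult X x) = mult Y (TA (TO X) (TO Y) (TA X Y f) x)"
proof -
  have "compose (pts (TO (TO X))) (mult Y) (TA (TO X) (TO Y) (TA X Y f)) =
      compose (pts (TO (TO X))) (TA X Y f) (mult X)"
    using mult_nat assms unfolding nat_trans_def by (auto simp: comp_functor_def)
  from fun_cong[OF this, of x] show ?thesis
    using assms(4) by (simp add: compose_def)
qed

lemma mult_unit: "X \<in> \<K> \<Longrightarrow> x \<in> pts (TO X) \<Longrightarrow> mult X (unit (TO X) x) = x"
  using monad_laws[of X] by (auto simp: compose_def ident_def fun_eq_iff split: if_splits)

lemma mult_TA_unit: "X \<in> \<K> \<Longrightarrow> x \<in> pts (TO X) \<Longrightarrow> mult X (TA X (TO X) (unit X) x) = x"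
  using monad_laws[of X] by (auto simp: compose_def ident_def fun_eq_iff split: if_splits)

lemma mult_mult:
  "X \<in> \<K> \<Longrightarrow> x \<in> pts (TO (TO (TO X))) \<Longrightarrow>
     mult X (mult (TO X) x) = mult X (TA (TO (TO X)) (TO X) (mult X) x)"
  using conjunct2[OF conjunct2[OF monad_laws[of X]]]
  by (auto simp: compose_def fun_eq_iff split: if_splits)

section \<open>Standard finite spaces, tuples and the algebra carried by T X\<close>

definition Nn :: "nat \<Rightarrow> 'u espace" where
  "Nn n = disc (pt ` {..<n})"

text \<open>A list of length n read as a map out of the standard n-element space. The restriction
  makes it extensional, as membership in \<open>hom\<close> demands.\<close>

definition tuple :: "'u list \<Rightarrow> 'u \<Rightarrow> 'u" where
  "tuple xs = restrict (\<lambda>u. xs ! inv pt u) (pt ` {..<length xs})"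

lemma pts_Nn [simp]: "pts (Nn n) = pt ` {..<n}"
  by (simp add: Nn_def)

lemma Nn_Set_f: "Nn n \<in> Set_f"
  by (simp add: Nn_def disc_in_Set_f)

lemma Nn_in: "Nn n \<in> \<K>"
  by (rule Set_f_in[OF Nn_Set_f])

lemma inv_pt [simp]: "inv pt (pt i) = i"
  using inj_pt by simp

lemma tuple_pt: "i < length xs \<Longrightarrow> tuple xs (pt i) = xs ! i"
  by (simp add: tuple_def)

lemma tuple_hom: "X \<in> \<K> \<Longrightarrow> set xs \<subseteq> pts X \<Longrightarrow> length xs = n \<Longrightarrow> tuple xs \<in> hom (Nn n) X"
  by (rule hom_from_Set_f[OF Nn_Set_f in_metric]) (auto simp: tuple_def subset_iff)

lemma compose_tuple: "length xs = n \<Longrightarrow> compose (pt ` {..<n}) f (tuple xs) = tuple (map f xs)"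
  by (auto simp: compose_def tuple_def fun_eq_iff)

lemma tuple_values: "f \<in> hom (Nn n) X \<Longrightarrow> tuple (map (\<lambda>i. f (pt i)) [0..<n]) = f"
  using hom_extensional[of f "Nn n" X]
  by (auto simp: tuple_def fun_eq_iff extensional_def)

text \<open>The sets for different n may overlap. This is harmless, since the length of the argument
  list fixes the arity of each occurrence, and \<open>free\<close> reads it off from there.\<close>

definition sig :: "'u signature" where
  "sig n = pts (TO (Nn n))"

text \<open>The operation of a symbol is the Kleisli extension of the argument tuple n \<rightarrow>
  T X, evaluated at that symbol.\<close>

definition free :: "'u espace \<Rightarrow> ('u, 'u) algebra" where
  "free X = \<lparr>under = TO X, opn = (\<lambda>\<sigma> xs. mult X (TA (Nn (length xs)) (TO X) (tuple xs) \<sigma>))\<rparr>"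

lemma under_free [simp]: "under (free X) = TO X"
  by (simp add: free_def)

lemma opn_free:
  "length xs = n \<Longrightarrow> opn (free X) \<sigma> xs = mult X (TA (Nn n) (TO X) (tuple xs) \<sigma>)"
  by (simp add: free_def)

section \<open>Identities and distance bounds in the algebras on T X\<close>

lemma opn_free_mem:
  assumes "X \<in> \<K>" "\<sigma> \<in> sig n" "set xs \<subseteq> pts (TO X)" "length xs = n"
  shows "opn (free X) \<sigma> xs \<in> pts (TO X)"
  unfolding opn_free[OF assms(4)]
  using assms by (intro hom_mem[OF mult_hom] hom_mem[OF TA_hom] TO_in Nn_in tuple_hom)
    (auto simp: sig_def)

text \<open>Here the enrichment of T enters: the supremum metric on maps n \<rightarrow> T X is the
  maximum metric on n-tuples, and \<open>TA_hdist\<close> says that T does not increase it.\<close>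

lemma opn_free_dst_args:
  assumes X: "X \<in> \<K>" and \<sigma>: "\<sigma> \<in> sig n"
    and xs: "set xs \<subseteq> pts (TO X)" "length xs = n" and ys: "set ys \<subseteq> pts (TO X)" "length ys = n"
  shows "dst (TO X) (opn (free X) \<sigma> xs) (opn (free X) \<sigma> ys) \<le> (SUP i\<in>{..<n}. dst (TO X) (xs ! i) (ys ! i))"
proof -
  note hx = tuple_hom[OF TO_in[OF X] xs] and hy = tuple_hom[OF TO_in[OF X] ys]
  have \<sigma>': "\<sigma> \<in> pts (TO (Nn n))" using \<sigma> by (simp add: sig_def)
  have "dst (TO X) (opn (free X) \<sigma> xs) (opn (free X) \<sigma> ys)
      \<le> dst (TO (TO X)) (TA (Nn n) (TO X) (tuple xs) \<sigma>) (TA (Nn n) (TO X) (tuple ys) \<sigma>)"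
    unfolding opn_free[OF xs(2)] opn_free[OF ys(2)]
    using \<sigma>' by (intro hom_dst[OF mult_hom[OF X]] hom_mem[OF TA_hom] Nn_in TO_in X hx hy)
  also have "\<dots> \<le> hdist (TO (Nn n)) (TO (TO X)) (TA (Nn n) (TO X) (tuple xs)) (TA (Nn n) (TO X) (tuple ys))"
    unfolding hdist_def by (rule SUP_upper[OF \<sigma>'])
  also have "\<dots> \<le> hdist (Nn n) (TO X) (tuple xs) (tuple ys)"
    by (rule TA_hdist[OF Nn_in TO_in[OF X] hx hy])
  also have "\<dots> = (SUP i\<in>{..<n}. dst (TO X) (xs ! i) (ys ! i))"
    unfolding hdist_def pts_Nn image_image using xs(2) ys(2) by (auto intro!: SUP_cong simp: tuple_pt)
  finally show ?thesis .
qed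

lemma free_quantitative: "X \<in> \<K> \<Longrightarrow> quantitative_algebra \<K> sig (free X)"
  unfolding quantitative_algebra_def
  using TO_in opn_free_mem opn_free_dst_args by (auto simp: in_lists_conv_set subset_iff)

text \<open>Naturality of the multiplication moves T f inside; functoriality then merges it with the
  tuple.\<close>

lemma TA_opn_free:
  assumes X: "X \<in> \<K>" and Y: "Y \<in> \<K>" and f: "f \<in> hom X Y" and \<sigma>: "\<sigma> \<in> sig n"
    and xs: "set xs \<subseteq> pts (TO X)" "length xs = n"
  shows "TA X Y f (opn (free X) \<sigma> xs) = opn (free Y) \<sigma> (map (TA X Y f) xs)"
proof -
  have \<sigma>': "\<sigma> \<in> pts (TO (Nn n))" using \<sigma> by (simp add: sig_def)
  note hx = tuple_hom[OF TO_in[OF X] xs] and hf = TA_hom[OF X Y f]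
  have "TA X Y f (opn (free X) \<sigma> xs) =
      mult Y (TA (TO X) (TO Y) (TA X Y f) (TA (Nn n) (TO X) (tuple xs) \<sigma>))"
    unfolding opn_free[OF xs(2)]
    by (rule TA_mult[OF X Y f hom_mem[OF TA_hom[OF Nn_in TO_in[OF X] hx] \<sigma>']])
  also have "\<dots> = mult Y (TA (Nn n) (TO Y) (compose (pts (Nn n)) (TA X Y f) (tuple xs)) \<sigma>)"
    by (subst TA_TA[OF Nn_in TO_in[OF X] TO_in[OF Y] hx hf \<sigma>']) (rule refl)
  finally show ?thesis
    using xs(2) by (simp add: compose_tuple opn_free)
qed

text \<open>This is the associativity law of the monad, evaluated at the image of
  \<open>\<sigma>\<close> under the tuple.\<close>

lemma mult_opn_free:
  assumes X: "X \<in> \<K>" and \<sigma>: "\<sigma> \<in> sig n"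
    and xs: "set xs \<subseteq> pts (TO (TO X))" "length xs = n"
  shows "mult X (opn (free (TO X)) \<sigma> xs) = opn (free X) \<sigma> (map (mult X) xs)"
proof -
  have \<sigma>': "\<sigma> \<in> pts (TO (Nn n))" using \<sigma> by (simp add: sig_def)
  note TX = TO_in[OF X] and TTX = TO_in[OF TO_in[OF X]]
  note hx = tuple_hom[OF TTX xs] and hm = mult_hom[OF X]
  have "mult X (opn (free (TO X)) \<sigma> xs) =
      mult X (TA (TO (TO X)) (TO X) (mult X) (TA (Nn n) (TO (TO X)) (tuple xs) \<sigma>))"
    unfolding opn_free[OF xs(2)]
    by (rule mult_mult[OF X hom_mem[OF TA_hom[OF Nn_in TTX hx] \<sigma>']])
  also have "\<dots> = mult X (TA (Nn n) (TO X) (compose (pts (Nn n)) (mult X) (tuple xs)) \<sigma>)"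
    by (subst TA_TA[OF Nn_in TTX TX hx hm \<sigma>']) (rule refl)
  finally show ?thesis
    using xs(2) by (simp add: compose_tuple opn_free)
qed

text \<open>By the unit law \<open>mult_TA_unit\<close>. Elements of T X coming from T n are thus
  values of operations at generators, so a homomorphism is determined there by its values on
  generators.\<close>

lemma opn_free_unit:
  assumes X: "X \<in> \<K>" and f: "f \<in> hom (Nn n) X" and \<sigma>: "\<sigma> \<in> sig n"
  shows "opn (free X) \<sigma> (map (\<lambda>i. unit X (f (pt i))) [0..<n]) = TA (Nn n) X f \<sigma>"
proof -
  have \<sigma>': "\<sigma> \<in> pts (TO (Nn n))" using \<sigma> by (simp add: sig_def)
  have "tuple (map (\<lambda>i. unit X (f (pt i))) [0..<n]) = compose (pts (Nn n)) (unit X) f"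
    using compose_tuple[of "map (\<lambda>i. f (pt i)) [0..<n]" n "unit X"] tuple_values[OF f]
    by (simp add: comp_def)
  then have "opn (free X) \<sigma> (map (\<lambda>i. unit X (f (pt i))) [0..<n]) =
      mult X (TA X (TO X) (unit X) (TA (Nn n) X f \<sigma>))"
    using TA_TA[OF Nn_in X TO_in[OF X] f unit_hom[OF X] \<sigma>'] by (simp add: opn_free[of _ n])
  then show ?thesis
    using mult_TA_unit[OF X hom_mem[OF TA_hom[OF Nn_in X f] \<sigma>']] by simp
qed

text \<open>Both T applied to the tuple and the multiplication are nonexpanding. The resulting
  quantitative equations record the metric of T n in the variety.\<close>

lemma opn_free_dst_symbols:
  assumes X: "X \<in> \<K>" and \<sigma>: "\<sigma> \<in> sig n" and \<tau>: "\<tau> \<in> sig n"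
    and xs: "set xs \<subseteq> pts (TO X)" "length xs = n"
  shows "dst (TO X) (opn (free X) \<sigma> xs) (opn (free X) \<tau> xs) \<le> dst (TO (Nn n)) \<sigma> \<tau>"
proof -
  have \<sigma>': "\<sigma> \<in> pts (TO (Nn n))" "\<tau> \<in> pts (TO (Nn n))" using \<sigma> \<tau> by (simp_all add: sig_def)
  note h = TA_hom[OF Nn_in TO_in[OF X] tuple_hom[OF TO_in[OF X] xs]]
  show ?thesis
    unfolding opn_free[OF xs(2)]
    by (rule order_trans[OF hom_dst[OF mult_hom[OF X] hom_mem[OF h \<sigma>'(1)] hom_mem[OF h \<sigma>'(2)]]
          hom_dst[OF h \<sigma>']])
qed

text \<open>Naturality of the unit and the law \<open>mult_unit\<close> make the unit at the i-th
  point act as the i-th projection.\<close>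

lemma opn_free_projection:
  assumes X: "X \<in> \<K>" and xs: "set xs \<subseteq> pts (TO X)" "length xs = n" and i: "i < n"
  shows "opn (free X) (unit (Nn n) (pt i)) xs = xs ! i"
proof -
  note hx = tuple_hom[OF TO_in[OF X] xs]
  have "TA (Nn n) (TO X) (tuple xs) (unit (Nn n) (pt i)) = unit (TO X) (tuple xs (pt i))"
    using fun_cong[OF TA_unit[OF Nn_in TO_in[OF X] hx], of "pt i"] i by (simp add: compose_def)
  moreover have "xs ! i \<in> pts (TO X)" using xs i by auto
  ultimately show ?thesis
    using xs i by (simp add: opn_free tuple_pt mult_unit[OF X])
qed

text \<open>For fixed \<open>xs\<close>, sending a symbol t of T n to its value at \<open>xs\<close>
  is T of the tuple followed by the multiplication. Both maps preserve operations by the two lemmas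
  above, hence so does the composite.\<close>

lemma opn_free_substitution:
  assumes X: "X \<in> \<K>" and \<sigma>: "\<sigma> \<in> sig m" and ts: "set ts \<subseteq> sig n" "length ts = m"
    and xs: "set xs \<subseteq> pts (TO X)" "length xs = n"
  shows "opn (free X) (opn (free (Nn n)) \<sigma> ts) xs =
    opn (free X) \<sigma> (map (\<lambda>t. opn (free X) t xs) ts)"
proof -
  note TX = TO_in[OF X]
  note hx = tuple_hom[OF TX xs]
  have ts': "set ts \<subseteq> pts (TO (Nn n))" using ts by (simp add: sig_def)
  have "opn (free X) (opn (free (Nn n)) \<sigma> ts) xs =
      mult X (opn (free (TO X)) \<sigma> (map (TA (Nn n) (TO X) (tuple xs)) ts))"
    using TA_opn_free[OF Nn_in TX hx \<sigma> ts' ts(2)] by (simp add: opn_free[OF xs(2)])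
  also have "\<dots> = opn (free X) \<sigma> (map (mult X) (map (TA (Nn n) (TO X) (tuple xs)) ts))"
    using ts' ts(2) by (intro mult_opn_free[OF X \<sigma>]) (auto intro: hom_mem[OF TA_hom[OF Nn_in TX hx]])
  finally show ?thesis
    by (simp add: opn_free[OF xs(2)] comp_def)
qed


section \<open>The variety of a strongly finitary monad\<close>

definition eqs :: "'u quantitative_equation set" where
  "eqs = {e. equation_over sig e \<and> (\<forall>X\<in>\<K>. satisfies (free X) e)}"

abbreviation \<V> :: "('u, 'u) algebra set" where "\<V> \<equiv> variety \<K> sig eqs"

lemma free_in_variety: "X \<in> \<K> \<Longrightarrow> free X \<in> \<V>"
  using free_quantitative by (auto simp: variety_def eqs_def)

text \<open>Transfer principle: a bound valid in all the algebras T X is one of the equations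
  \<open>eqs\<close>, so it holds in every algebra of the variety. Variables are positions, and
  \<open>(!) xs\<close> is the assignment given by an argument list.\<close>

lemma variety_satisfies:
  assumes "A \<in> \<V>" "equation_over sig \<lparr>vars = {..<n}, lhs = s, rhs = t, bound = r\<rparr>"
    and "\<And>X f. X \<in> \<K> \<Longrightarrow> f \<in> {..<n} \<rightarrow> pts (TO X) \<Longrightarrow>
      dst (TO X) (eval (free X) f s) (eval (free X) f t) \<le> ennreal r"
    and "set xs \<subseteq> pts (under A)" "length xs = n"
  shows "dst (under A) (eval A ((!) xs) s) (eval A ((!) xs) t) \<le> ennreal r"
proof -
  have "\<lparr>vars = {..<n}, lhs = s, rhs = t, bound = r\<rparr> \<in> eqs"
    using assms(2,3) by (auto simp: eqs_def satisfies_def)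
  then have "satisfies A \<lparr>vars = {..<n}, lhs = s, rhs = t, bound = r\<rparr>"
    using assms(1) by (auto simp: variety_def)
  moreover have "(!) xs \<in> {..<n} \<rightarrow> pts (under A)"
    using assms(4,5) by auto
  ultimately show ?thesis
    by (simp add: satisfies_def)
qed

section \<open>Transfer of these identities and bounds to all algebras of the variety\<close>

lemma variety_in: "A \<in> \<V> \<Longrightarrow> under A \<in> \<K>"
  by (simp add: variety_def quantitative_algebra_def)

lemma opn_mem:
  assumes "A \<in> \<V>" "\<sigma> \<in> sig n" "set xs \<subseteq> pts (under A)" "length xs = n"
  shows "opn A \<sigma> xs \<in> pts (under A)"
  using assms by (auto simp: variety_def quantitative_algebra_def in_lists_conv_set subset_iff)

lemma opn_dst_args:
  assumes "A \<in> \<V>" "\<sigma> \<in> sig n" "set xs \<subseteq> pts (under A)" "length xs = n"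
    "set ys \<subseteq> pts (under A)" "length ys = n"
  shows "dst (under A) (opn A \<sigma> xs) (opn A \<sigma> ys) \<le> (SUP i\<in>{..<n}. dst (under A) (xs ! i) (ys ! i))"
  using assms by (auto simp: variety_def quantitative_algebra_def in_lists_conv_set subset_iff)

lemma App_Vars_in_terms: "\<sigma> \<in> sig n \<Longrightarrow> App \<sigma> (map Var [0..<n]) \<in> terms sig {..<n}"
  by (auto intro!: terms.intros)

lemma eval_App_Vars: "eval A f (App \<sigma> (map Var [0..<n])) = opn A \<sigma> (map f [0..<n])"
  by (simp add: comp_def)

lemma map_nth_upt: "length xs = n \<Longrightarrow> map ((!) xs) [0..<n] = xs"
  using map_nth by auto

text \<open>Bounds of equations are real, so only a finite distance of symbols gives an equation;
  for an infinite distance the claim is trivial.\<close>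

lemma opn_dst_symbols:
  assumes A: "A \<in> \<V>" and \<sigma>: "\<sigma> \<in> sig n" and \<tau>: "\<tau> \<in> sig n"
    and xs: "set xs \<subseteq> pts (under A)" "length xs = n"
  shows "dst (under A) (opn A \<sigma> xs) (opn A \<tau> xs) \<le> dst (TO (Nn n)) \<sigma> \<tau>"
proof (cases "dst (TO (Nn n)) \<sigma> \<tau>")
  case (real r)
  have "dst (under A) (eval A ((!) xs) (App \<sigma> (map Var [0..<n])))
      (eval A ((!) xs) (App \<tau> (map Var [0..<n]))) \<le> ennreal r"
  proof (rule variety_satisfies[OF A _ _ xs])
    show "equation_over sig \<lparr>vars = {..<n}, lhs = App \<sigma> (map Var [0..<n]),
        rhs = App \<tau> (map Var [0..<n]), bound = r\<rparr>"
      using App_Vars_in_terms \<sigma> \<tau> real by (simp add: equation_over_def)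
  next
    fix X f assume "X \<in> \<K>" and f: "f \<in> {..<n} \<rightarrow> pts (TO X)"
    then show "dst (TO X) (eval (free X) f (App \<sigma> (map Var [0..<n])))
        (eval (free X) f (App \<tau> (map Var [0..<n]))) \<le> ennreal r"
      unfolding eval_App_Vars real(2)[symmetric]
      by (intro opn_free_dst_symbols \<sigma> \<tau>) auto
  qed
  then show ?thesis
    unfolding eval_App_Vars real(2) map_nth_upt[OF xs(2)] .
qed simp

text \<open>An equation with bound 0 forces distance 0, hence equality, in the metric space
  underlying \<open>A\<close>.\<close>

lemma opn_projection:
  assumes A: "A \<in> \<V>" and xs: "set xs \<subseteq> pts (under A)" "length xs = n" and i: "i < n"
  shows "opn A (unit (Nn n) (pt i)) xs = xs ! i"
proof -
  let ?\<sigma> = "unit (Nn n) (pt i)"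
  have \<sigma>: "?\<sigma> \<in> sig n"
    using hom_mem[OF unit_hom[OF Nn_in[of n]]] i by (simp add: sig_def)
  have "dst (under A) (eval A ((!) xs) (App ?\<sigma> (map Var [0..<n])))
      (eval A ((!) xs) (Var i)) \<le> ennreal 0"
  proof (rule variety_satisfies[OF A _ _ xs])
    show "equation_over sig \<lparr>vars = {..<n}, lhs = App ?\<sigma> (map Var [0..<n]),
        rhs = Var i, bound = 0\<rparr>"
      using App_Vars_in_terms[OF \<sigma>] i by (auto simp: equation_over_def intro: terms.intros)
  next
    fix X f assume X: "X \<in> \<K>" and f: "f \<in> {..<n} \<rightarrow> pts (TO X)"
    then have "opn (free X) ?\<sigma> (map f [0..<n]) = f i"
      using i by (subst opn_free_projection[of X _ n]) auto
    moreover have "f i \<in> pts (TO X)" using f i by auto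
    ultimately show "dst (TO X) (eval (free X) f (App ?\<sigma> (map Var [0..<n])))
        (eval (free X) f (Var i)) \<le> ennreal 0"
      unfolding eval_App_Vars using ext_metricD(1)[OF in_metric[OF TO_in[OF X]]] by simp
  qed
  then have "dst (under A) (opn A ?\<sigma> xs) (xs ! i) = 0"
    unfolding eval_App_Vars map_nth_upt[OF xs(2)] by simp
  moreover have "xs ! i \<in> pts (under A)" using xs i by auto
  ultimately show ?thesis
    using ext_metricD(2)[OF in_metric[OF variety_in[OF A]]] opn_mem[OF A \<sigma> xs] by auto
qed

lemma opn_substitution:
  assumes A: "A \<in> \<V>" and \<sigma>: "\<sigma> \<in> sig m" and ts: "set ts \<subseteq> sig n" "length ts = m"
    and xs: "set xs \<subseteq> pts (under A)" "length xs = n"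
  shows "opn A (opn (free (Nn n)) \<sigma> ts) xs = opn A \<sigma> (map (\<lambda>t. opn A t xs) ts)"
proof -
  let ?\<tau> = "opn (free (Nn n)) \<sigma> ts"
  let ?r = "App \<sigma> (map (\<lambda>t. App t (map Var [0..<n])) ts)"
  have eval_r: "eval B f ?r = opn B \<sigma> (map (\<lambda>t. opn B t (map f [0..<n])) ts)" for B :: "('u, 'u) algebra" and f
    by (simp add: comp_def)
  have \<tau>: "?\<tau> \<in> sig n"
    using opn_free_mem[OF Nn_in \<sigma> _ ts(2), of n] ts(1) by (simp add: sig_def)
  have "t \<in> terms sig {..<n}" if "t \<in> set (map (\<lambda>t. App t (map Var [0..<n])) ts)" for t
    using that ts App_Vars_in_terms[of _ n] unfolding set_map by blast
  then have r: "?r \<in> terms sig {..<n}"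
    using \<sigma> ts(2) by (intro terms.App) simp_all
  have "dst (under A) (eval A ((!) xs) (App ?\<tau> (map Var [0..<n]))) (eval A ((!) xs) ?r) \<le> ennreal 0"
  proof (rule variety_satisfies[OF A _ _ xs])
    show "equation_over sig \<lparr>vars = {..<n}, lhs = App ?\<tau> (map Var [0..<n]), rhs = ?r, bound = 0\<rparr>"
      using App_Vars_in_terms[OF \<tau>] r by (simp add: equation_over_def)
  next
    fix X f assume X: "X \<in> \<K>" and "f \<in> {..<n} \<rightarrow> pts (TO X)"
    then have f: "set (map f [0..<n]) \<subseteq> pts (TO X)" by auto
    have "opn (free X) ?\<tau> (map f [0..<n]) \<in> pts (TO X)"
      by (rule opn_free_mem[OF X \<tau> f]) simp
    then show "dst (TO X) (eval (free X) f (App ?\<tau> (map Var [0..<n]))) (eval (free X) f ?r) \<le> ennreal 0"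
      unfolding eval_App_Vars eval_r
      using opn_free_substitution[OF X \<sigma> ts f] ext_metricD(1)[OF in_metric[OF TO_in[OF X]]] by simp
  qed
  then have "dst (under A) (opn A ?\<tau> xs) (opn A \<sigma> (map (\<lambda>t. opn A t xs) ts)) = 0"
    unfolding eval_App_Vars eval_r map_nth_upt[OF xs(2)] by simp
  moreover have "opn A \<sigma> (map (\<lambda>t. opn A t xs) ts) \<in> pts (under A)"
    using ts opn_mem[OF A _ xs] by (intro opn_mem[OF A \<sigma>]) auto
  ultimately show ?thesis
    using ext_metricD(2)[OF in_metric[OF variety_in[OF A]]] opn_mem[OF A \<tau> xs] by auto
qed

text \<open>Renaming is substitution of projections: by \<open>opn_free_unit\<close> the renamed
  symbol is \<open>\<sigma>\<close> applied to the units at the points k(i), and each of these acts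
  as a projection.\<close>

lemma opn_rename:
  assumes A: "A \<in> \<V>" and k: "k \<in> hom (Nn m) (Nn n)" and \<sigma>: "\<sigma> \<in> sig m"
    and xs: "set xs \<subseteq> pts (under A)" "length xs = n"
  shows "opn A (TA (Nn m) (Nn n) k \<sigma>) xs = opn A \<sigma> (map (\<lambda>i. tuple xs (k (pt i))) [0..<m])"
proof -
  let ?ts = "map (\<lambda>i. unit (Nn n) (k (pt i))) [0..<m]"
  have kpt: "k (pt i) \<in> pt ` {..<n}" if "i < m" for i
    using hom_mem[OF k, of "pt i"] that by simp
  then have ts: "set ?ts \<subseteq> sig n"
    using hom_mem[OF unit_hom[OF Nn_in[of n]]] by (auto simp: sig_def)
  have "opn A (unit (Nn n) (k (pt i))) xs = tuple xs (k (pt i))" if "i < m" for i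
    using kpt[OF that] opn_projection[OF A xs] xs(2) by (auto simp: tuple_pt)
  then have "map (\<lambda>t. opn A t xs) ?ts = map (\<lambda>i. tuple xs (k (pt i))) [0..<m]"
    by simp
  moreover have "opn A (opn (free (Nn n)) \<sigma> ?ts) xs = opn A \<sigma> (map (\<lambda>t. opn A t xs) ?ts)"
    by (rule opn_substitution[OF A \<sigma> ts _ xs]) simp
  ultimately show ?thesis
    by (simp only: opn_free_unit[OF Nn_in k \<sigma>])
qed

section \<open>Enumerated finite discrete spaces and the action of T N on algebras\<close>

definition enum :: "'u espace \<Rightarrow> 'u list" where
  "enum N = (SOME xs. distinct xs \<and> set xs = pts N)"

text \<open>Cocones range over all finite discrete spaces, while symbols exist only at the standard
  ones. The chosen listing connects the two: a point goes to a position at which it is listed, and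
  \<open>tuple (enum N)\<close> leads back.\<close>

definition index :: "'u espace \<Rightarrow> 'u \<Rightarrow> 'u" where
  "index N = restrict (\<lambda>x. pt (SOME i. i < length (enum N) \<and> enum N ! i = x)) (pts N)"

abbreviation size_of :: "'u espace \<Rightarrow> nat" where
  "size_of N \<equiv> length (enum N)"

lemma set_enum: "N \<in> Set_f \<Longrightarrow> set (enum N) = pts N"
  unfolding enum_def Set_f_def
  by (rule someI2_ex) (auto dest: finite_distinct_list)

lemma index_at:
  assumes "N \<in> Set_f" "x \<in> pts N"
  obtains i where "index N x = pt i" "i < size_of N" "enum N ! i = x"
proof -
  have "\<exists>i. i < size_of N \<and> enum N ! i = x"
    using assms set_enum by (metis in_set_conv_nth)
  from someI_ex[OF this] show ?thesis
    using that assms(2) by (auto simp: index_def)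
qed

lemma index_hom: "N \<in> Set_f \<Longrightarrow> index N \<in> hom N (Nn (size_of N))"
  by (rule hom_from_Set_f[OF _ in_metric[OF Nn_in]])
    (auto simp: index_def elim!: index_at)

lemma enum_hom: "N \<in> Set_f \<Longrightarrow> tuple (enum N) \<in> hom (Nn (size_of N)) N"
  by (rule tuple_hom[OF Set_f_in]) (auto simp: set_enum)

lemma compose_enum_index:
  assumes "N \<in> Set_f"
  shows "compose (pts N) (tuple (enum N)) (index N) = ident N"
proof
  fix x show "compose (pts N) (tuple (enum N)) (index N) x = ident N x"
    by (cases "x \<in> pts N") (auto simp: compose_def ident_def tuple_pt elim: index_at[OF assms])
qed

lemma TA_enum_index:
  assumes "N \<in> Set_f" "t \<in> pts (TO N)"
  shows "TA (Nn (size_of N)) N (tuple (enum N)) (TA N (Nn (size_of N)) (index N) t) = t"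
proof -
  have "ident (TO N) t = t" using assms(2) by (simp add: ident_def)
  then show ?thesis
    using TA_TA[OF Set_f_in[OF assms(1)] Nn_in Set_f_in[OF assms(1)] index_hom[OF assms(1)]
        enum_hom[OF assms(1)] assms(2)]
    by (simp add: compose_enum_index[OF assms(1)] TA_ident[OF Set_f_in[OF assms(1)]])
qed

lemma TA_index_sig: "N \<in> Set_f \<Longrightarrow> t \<in> pts (TO N) \<Longrightarrow> TA N (Nn (size_of N)) (index N) t \<in> sig (size_of N)"
  unfolding sig_def by (rule hom_mem[OF TA_hom[OF Set_f_in Nn_in index_hom]])

text \<open>The value of an element t of T N, for any finite discrete N, under the valuation
  \<open>v\<close>: t is transported to a symbol and applied to the listed values.\<close>

definition act :: "('u, 'u) algebra \<Rightarrow> 'u espace \<Rightarrow> ('u \<Rightarrow> 'u) \<Rightarrow> 'u \<Rightarrow> 'u" where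
  "act A N v t = opn A (TA N (Nn (size_of N)) (index N) t) (map v (enum N))"

lemma act_mem:
  assumes "A \<in> \<V>" "N \<in> Set_f" "\<And>x. x \<in> pts N \<Longrightarrow> v x \<in> pts (under A)" "t \<in> pts (TO N)"
  shows "act A N v t \<in> pts (under A)"
  unfolding act_def using assms(3)
  by (intro opn_mem[OF assms(1) TA_index_sig[OF assms(2,4)]]) (auto simp: set_enum[OF assms(2)])

lemma act_dst_symbols:
  assumes "A \<in> \<V>" "N \<in> Set_f" "\<And>x. x \<in> pts N \<Longrightarrow> v x \<in> pts (under A)"
    and "s \<in> pts (TO N)" "t \<in> pts (TO N)"
  shows "dst (under A) (act A N v s) (act A N v t) \<le> dst (TO N) s t"
proof -
  have "dst (under A) (act A N v s) (act A N v t) \<le>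
      dst (TO (Nn (size_of N))) (TA N (Nn (size_of N)) (index N) s) (TA N (Nn (size_of N)) (index N) t)"
    unfolding act_def using assms
    by (intro opn_dst_symbols[OF assms(1)] TA_index_sig) (auto simp: set_enum)
  also have "\<dots> \<le> dst (TO N) s t"
    using assms by (intro hom_dst[OF TA_hom] Set_f_in Nn_in index_hom)
  finally show ?thesis .
qed

lemma act_dst_args:
  assumes "A \<in> \<V>" "N \<in> Set_f" "\<And>x. x \<in> pts N \<Longrightarrow> v x \<in> pts (under A)"
    and "\<And>x. x \<in> pts N \<Longrightarrow> w x \<in> pts (under A)" "t \<in> pts (TO N)"
  shows "dst (under A) (act A N v t) (act A N w t) \<le> (SUP x\<in>pts N. dst (under A) (v x) (w x))"
proof -
  have "dst (under A) (act A N v t) (act A N w t) \<le>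
      (SUP i\<in>{..<size_of N}. dst (under A) (map v (enum N) ! i) (map w (enum N) ! i))"
    unfolding act_def using assms
    by (intro opn_dst_args[OF assms(1)] TA_index_sig) (auto simp: set_enum)
  also have "\<dots> \<le> (SUP x\<in>pts N. dst (under A) (v x) (w x))"
    using nth_mem[of _ "enum N"] by (intro SUP_least) (auto simp: set_enum[OF assms(2)] intro!: SUP_upper)
  finally show ?thesis .
qed

text \<open>Conjugating \<open>h\<close> by the listings gives a map \<open>k\<close> of standard
  spaces, to which \<open>opn_rename\<close> applies. This is the compatibility required of a
  weighted cocone.\<close>

lemma act_natural:
  assumes A: "A \<in> \<V>" and M: "M \<in> Set_f" and N: "N \<in> Set_f" and h: "h \<in> hom M N"
    and v: "\<And>x. x \<in> pts N \<Longrightarrow> v x \<in> pts (under A)" and t: "t \<in> pts (TO M)"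
  shows "act A N v (TA M N h t) = act A M (\<lambda>x. v (h x)) t"
proof -
  let ?m = "size_of M" and ?n = "size_of N"
  note MK = Set_f_in[OF M] and NK = Set_f_in[OF N]
  note [intro] = MK NK Nn_in index_hom[OF M] index_hom[OF N] enum_hom[OF M] h
  define k where "k = compose (pts (Nn ?m)) (index N) (compose (pts (Nn ?m)) h (tuple (enum M)))"
  have he: "compose (pts (Nn ?m)) h (tuple (enum M)) \<in> hom (Nn ?m) N"
    by (rule compose_hom) auto
  have k: "k \<in> hom (Nn ?m) (Nn ?n)"
    unfolding k_def by (rule compose_hom[OF he]) auto
  let ?s = "TA M (Nn ?m) (index M) t"
  have s: "?s \<in> pts (TO (Nn ?m))"
    using TA_index_sig[OF M t] by (simp add: sig_def)
  have "TA (Nn ?m) (Nn ?n) k ?s = TA N (Nn ?n) (index N) (TA (Nn ?m) N (compose (pts (Nn ?m)) h (tuple (enum M))) ?s)"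
    unfolding k_def by (rule TA_TA[symmetric]) (use he s in auto)
  also have "TA (Nn ?m) N (compose (pts (Nn ?m)) h (tuple (enum M))) ?s = TA M N h (TA (Nn ?m) M (tuple (enum M)) ?s)"
    by (rule TA_TA[symmetric]) (use s in auto)
  also have "TA (Nn ?m) M (tuple (enum M)) ?s = t"
    by (rule TA_enum_index[OF M t])
  finally have "act A N v (TA M N h t) = opn A (TA (Nn ?m) (Nn ?n) k ?s) (map v (enum N))"
    by (simp add: act_def)
  also have "\<dots> = opn A ?s (map (\<lambda>i. tuple (map v (enum N)) (k (pt i))) [0..<?m])"
    using v by (intro opn_rename[OF A k TA_index_sig[OF M t]]) (auto simp: set_enum[OF N])
  also have "map (\<lambda>i. tuple (map v (enum N)) (k (pt i))) [0..<?m] = map (\<lambda>x. v (h x)) (enum M)"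
  proof (rule nth_equalityI)
    fix i assume "i < length (map (\<lambda>i. tuple (map v (enum N)) (k (pt i))) [0..<?m])"
    then have i: "i < ?m" by simp
    then have "h (enum M ! i) \<in> pts N"
      using hom_mem[OF h] set_enum[OF M] nth_mem[OF i] by simp
    from index_at[OF N this] obtain j
      where "index N (h (enum M ! i)) = pt j" "j < ?n" "enum N ! j = h (enum M ! i)" .
    then show "map (\<lambda>i. tuple (map v (enum N)) (k (pt i))) [0..<?m] ! i = map (\<lambda>x. v (h x)) (enum M) ! i"
      using i by (simp add: k_def compose_def tuple_pt)
  qed simp
  finally show ?thesis
    by (simp add: act_def)
qed

text \<open>The listing chosen for a standard space need not follow the order of the points
  \<open>pt i\<close>; \<open>opn_rename\<close> along \<open>index\<close> corrects for
  this.\<close>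

lemma act_Nn:
  assumes A: "A \<in> \<V>" and v: "\<And>i. i < n \<Longrightarrow> v (pt i) \<in> pts (under A)" and t: "t \<in> sig n"
  shows "act A (Nn n) v t = opn A t (map (\<lambda>i. v (pt i)) [0..<n])"
proof -
  let ?m = "size_of (Nn n)"
  have "act A (Nn n) v t = opn A t (map (\<lambda>i. tuple (map v (enum (Nn n))) (index (Nn n) (pt i))) [0..<n])"
    unfolding act_def using v
    by (intro opn_rename[OF A index_hom[OF Nn_Set_f] t]) (auto simp: set_enum[OF Nn_Set_f])
  also have "map (\<lambda>i. tuple (map v (enum (Nn n))) (index (Nn n) (pt i))) [0..<n] = map (\<lambda>i. v (pt i)) [0..<n]"
  proof (rule map_cong[OF refl])
    fix i assume "i \<in> set [0..<n]"
    then have "pt i \<in> pts (Nn n)" by simp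
    from index_at[OF Nn_Set_f this] show "tuple (map v (enum (Nn n))) (index (Nn n) (pt i)) = v (pt i)"
      by (metis length_map nth_map tuple_pt)
  qed
  finally show ?thesis .
qed


section \<open>Density of the finitely generated elements\<close>

lemma induced_cocone_eq:
  assumes "N \<in> Set_f" "X \<in> \<K>" "f \<in> hom N X"
  shows "induced_cocone (functor_of T) (functor_of T) (\<lambda>N. ident (TO N)) X g N f =
    compose (pts (TO N)) g (TA N X f)"
  by (auto simp: induced_cocone_def compose_def ident_def fun_eq_iff)

lemma Kan_factorization:
  assumes "X \<in> \<K>" "Y \<in> \<K>" "weighted_cocone Set_f (functor_of T) X Y \<alpha>"
  shows "\<exists>!g. g \<in> hom (TO X) Y \<and> (\<forall>N\<in>Set_f. \<forall>f\<in>hom N X. \<alpha> N f = compose (pts (TO N)) g (TA N X f))"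
proof -
  have "\<exists>!g. g \<in> hom (TO X) Y \<and> (\<forall>N\<in>Set_f. \<forall>f\<in>hom N X. \<alpha> N f =
      induced_cocone (functor_of T) (functor_of T) (\<lambda>N. ident (TO N)) X g N f)"
    using kan assms unfolding is_left_Kan_extension_def by blast
  then show ?thesis
    using assms(1) by (simp add: induced_cocone_eq cong: conj_cong)
qed

text \<open>The colimit cocone of T X with its codomain cut down to a set \<open>C\<close> that
  contains all its values. Taking all of T X for \<open>C\<close> gives the colimit cocone
  itself.\<close>

lemma TA_cocone:
  assumes X: "X \<in> \<K>" and C: "C \<subseteq> pts (TO X)"
    and mem: "\<And>N f t. N \<in> Set_f \<Longrightarrow> f \<in> hom N X \<Longrightarrow> t \<in> pts (TO N) \<Longrightarrow> TA N X f t \<in> C"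
  shows "weighted_cocone Set_f (functor_of T) X (subspace (TO X) C) (\<lambda>N. TA N X)"
  unfolding weighted_cocone_def
proof (intro conjI ballI)
  fix N f assume N: "N \<in> Set_f" and f: "f \<in> hom N X"
  note h = TA_hom[OF Set_f_in[OF N] X f]
  show "TA N X f \<in> hom (TO N) (subspace (TO X) C)"
    using hom_extensional[OF h] hom_dst[OF h] mem[OF N f]
    by (intro homI) (auto simp: subspace_def)
  fix g assume g: "g \<in> hom N X"
  have "hdist (TO N) (subspace (TO X) C) (TA N X f) (TA N X g) = hdist (TO N) (TO X) (TA N X f) (TA N X g)"
    unfolding hdist_def using mem[OF N f] mem[OF N g] by (intro SUP_cong) (auto simp: subspace_def)
  also have "\<dots> \<le> hdist N X f g"
    by (rule TA_hdist[OF Set_f_in[OF N] X f g])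
  finally show "hdist (TO N) (subspace (TO X) C) (TA N X f) (TA N X g) \<le> hdist N X f g" .
next
  fix M N h f assume "M \<in> Set_f" "N \<in> Set_f" "h \<in> hom M N" "f \<in> hom N X"
  then show "TA M X (compose (pts M) f h) = compose (pts (TO M)) (TA N X f) (TA M N h)"
    by (intro TA_compose Set_f_in X)
qed

section \<open>Elements generated by finite subsets\<close>

definition incl :: "'u set \<Rightarrow> 'u \<Rightarrow> 'u" where
  "incl S = restrict (\<lambda>x. x) S"

lemma incl_hom:
  assumes "X \<in> \<K>" "finite S" "S \<subseteq> pts X"
  shows "incl S \<in> hom (disc S) X"
  using assms(3)
  by (intro hom_from_Set_f[OF disc_in_Set_f[OF assms(2)] in_metric[OF assms(1)]])
    (auto simp: incl_def)

lemma incl_disc_hom: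
  assumes "finite S" "S \<subseteq> S'" "finite S'"
  shows "incl S \<in> hom (disc S) (disc S')"
  using assms by (intro incl_hom Set_f_in disc_in_Set_f) auto

text \<open>The set S carries the discrete metric and not that of X, so that it belongs to
  \<open>Set_f\<close>.\<close>

definition fin_gen :: "'u espace \<Rightarrow> 'u set \<Rightarrow> 'u set" where
  "fin_gen X S = TA (disc S) X (incl S) ` pts (TO (disc S))"

lemma fin_gen_subset: "X \<in> \<K> \<Longrightarrow> finite S \<Longrightarrow> S \<subseteq> pts X \<Longrightarrow> fin_gen X S \<subseteq> pts (TO X)"
  unfolding fin_gen_def
  by (intro image_subsetI hom_mem[OF TA_hom[OF Set_f_in[OF disc_in_Set_f]]] incl_hom)

text \<open>The inclusion of S factors through that of S'. Monotonicity gives finitely many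
  generated elements a common finite support.\<close>

lemma fin_gen_mono:
  assumes X: "X \<in> \<K>" and S: "finite S'" "S \<subseteq> S'" "S' \<subseteq> pts X"
  shows "fin_gen X S \<subseteq> fin_gen X S'"
proof
  fix u assume "u \<in> fin_gen X S"
  then obtain s where s: "s \<in> pts (TO (disc S))" "u = TA (disc S) X (incl S) s"
    by (auto simp: fin_gen_def)
  have fS: "finite S" using S by (auto intro: finite_subset)
  note D = Set_f_in[OF disc_in_Set_f[OF fS]] and D' = Set_f_in[OF disc_in_Set_f[OF S(1)]]
  note h = incl_disc_hom[OF fS S(2,1)] and h' = incl_hom[OF X S(1,3)]
  have "compose (pts (disc S)) (incl S') (incl S) = incl S"
    using S(2) by (auto simp: compose_def incl_def fun_eq_iff)
  then have "u = TA (disc S') X (incl S') (TA (disc S) (disc S') (incl S) s)"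
    using TA_TA[OF D D' X h h' s(1)] s(2) by simp
  then show "u \<in> fin_gen X S'"
    unfolding fin_gen_def using hom_mem[OF TA_hom[OF D D' h] s(1)] by (rule image_eqI)
qed

text \<open>The map \<open>f\<close> factors through its finite image with the discrete metric,
  since every map out of \<open>N\<close> is nonexpanding.\<close>

lemma TA_in_fin_gen:
  assumes X: "X \<in> \<K>" and N: "N \<in> Set_f" and f: "f \<in> hom N X" and t: "t \<in> pts (TO N)"
  shows "TA N X f t \<in> fin_gen X (f ` pts N)"
proof -
  let ?S = "f ` pts N"
  have S: "finite ?S" "?S \<subseteq> pts X" using N hom_mem[OF f] by (auto simp: Set_f_def)
  note NK = Set_f_in[OF N] and D = Set_f_in[OF disc_in_Set_f[OF S(1)]]
  have f': "f \<in> hom N (disc ?S)"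
    by (rule hom_from_Set_f[OF N in_metric[OF D] hom_extensional[OF f]]) simp
  have "compose (pts N) (incl ?S) f = f"
    using hom_extensional[OF f] by (auto simp: compose_def incl_def fun_eq_iff extensional_def)
  then have "TA N X f t = TA (disc ?S) X (incl ?S) (TA N (disc ?S) f t)"
    using TA_TA[OF NK D X f' incl_hom[OF X S] t] by simp
  then show ?thesis
    unfolding fin_gen_def using hom_mem[OF TA_hom[OF NK D f'] t] by (rule image_eqI)
qed

text \<open>
  The colimit cocone of \<open>T X\<close> factors through the closure of the set of finitely generated
  elements, which is an object of the category; so the inclusion of this closure splits.
\<close>

lemma fin_gen_dense:
  assumes X: "X \<in> \<K>" and u: "u \<in> pts (TO X)" and \<delta>: "\<delta> > 0"
  shows "\<exists>S. finite S \<and> S \<subseteq> pts X \<and> (\<exists>c\<in>fin_gen X S. dst (TO X) c u < \<delta>)"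
proof -
  \<comment> \<open>The closure of the union of all \<open>fin_gen X S\<close>.\<close>
  define C where "C = {u \<in> pts (TO X). \<forall>\<delta>>0. \<exists>S. finite S \<and> S \<subseteq> pts X \<and>
    (\<exists>c\<in>fin_gen X S. dst (TO X) c u < \<delta>)}"
  note TX = TO_in[OF X]
  note metric = ext_metricD[OF in_metric[OF TX]]
  have C: "C \<subseteq> pts (TO X)" by (auto simp: C_def)
  have mem: "TA N X f t \<in> C" if "N \<in> Set_f" "f \<in> hom N X" "t \<in> pts (TO N)" for N f t
  proof -
    have 1: "TA N X f t \<in> pts (TO X)"
      by (rule hom_mem[OF TA_hom[OF Set_f_in[OF that(1)] X that(2)] that(3)])
    then have "dst (TO X) (TA N X f t) (TA N X f t) = 0" by (rule metric(1))
    moreover have "finite (f ` pts N)" "f ` pts N \<subseteq> pts X"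
      using that(1) hom_mem[OF that(2)] by (auto simp: Set_f_def)
    ultimately show ?thesis
      using 1 TA_in_fin_gen[OF X that] unfolding C_def by (auto intro!: exI[of _ "f ` pts N"] bexI)
  qed
  have "subspace (TO X) C \<in> \<K>"
  proof (rule subspace_in_category[OF universe base TX C])
    fix l assume l: "l \<in> pts (TO X)" "\<And>e. e > 0 \<Longrightarrow> \<exists>c\<in>C. dst (TO X) c l < e"
    have "\<exists>S. finite S \<and> S \<subseteq> pts X \<and> (\<exists>c\<in>fin_gen X S. dst (TO X) c l < \<delta>)" if \<delta>: "\<delta> > 0" for \<delta>
    proof -
      obtain e where e: "e > 0" "e + e = \<delta>"
        using ennreal_half[OF \<delta>] .
      obtain c where c: "c \<in> C" "dst (TO X) c l < e" using l(2)[OF e(1)] by blast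
      then obtain S c' where S: "finite S" "S \<subseteq> pts X" "c' \<in> fin_gen X S" "dst (TO X) c' c < e"
        using e(1) unfolding C_def by blast
      have "c \<in> pts (TO X)" "c' \<in> pts (TO X)"
        using C c(1) fin_gen_subset[OF X S(1,2)] S(3) by auto
      then have "dst (TO X) c' l \<le> dst (TO X) c' c + dst (TO X) c l"
        using l(1) by (intro metric(4))
      also have "\<dots> < e + e"
        by (rule add_strict_mono[OF S(4) c(2)])
      finally show ?thesis using S e(2) by auto
    qed
    then show "l \<in> C" using l(1) by (auto simp: C_def)
  qed
  from Kan_factorization[OF X this TA_cocone[OF X C]] mem
  obtain g where g: "g \<in> hom (TO X) (subspace (TO X) C)"
    "\<And>N f. N \<in> Set_f \<Longrightarrow> f \<in> hom N X \<Longrightarrow> TA N X f = compose (pts (TO N)) g (TA N X f)"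
    by (metis (no_types, lifting))
  \<comment> \<open>Equality of records holds because distances are normalized to 0 outside the
    carrier.\<close>
  have full: "subspace (TO X) (pts (TO X)) = TO X"
    using in_metric[OF TX] by (cases "TO X") (auto simp: subspace_def ext_metric_space_def fun_eq_iff)
  have gC: "g x \<in> C" if "x \<in> pts (TO X)" for x
    using hom_mem[OF g(1) that] by (simp add: subspace_def)
  have g': "g \<in> hom (TO X) (TO X)"
    using hom_extensional[OF g(1)] gC hom_dst[OF g(1)] C
    by (intro homI) (auto simp: subspace_def)
  \<comment> \<open>Followed by the inclusion of the closure, \<open>g\<close> factors the colimit
    cocone, and so does the identity. Uniqueness makes them equal, so each u equals g u and lies in
    the closure.\<close>
  have "weighted_cocone Set_f (functor_of T) X (TO X) (\<lambda>N. TA N X)"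
    using TA_cocone[OF X order_refl] hom_mem[OF TA_hom[OF Set_f_in X]] unfolding full by blast
  from Kan_factorization[OF X TX this] g' g(2) ident_hom[of "TO X"] compose_ident[OF TA_hom[OF Set_f_in X]]
  have "g = ident (TO X)" by metis
  then have "g u = u" using u by (simp add: ident_def)
  then show ?thesis
    using gC[OF u] \<delta> by (auto simp: C_def)
qed

lemma fin_gen_dense_list:
  assumes X: "X \<in> \<K>" and us: "set us \<subseteq> pts (TO X)" and \<delta>: "\<delta> > 0"
  shows "\<exists>S cs. finite S \<and> S \<subseteq> pts X \<and> set cs \<subseteq> fin_gen X S \<and>
    list_all2 (\<lambda>c u. dst (TO X) c u < \<delta>) cs us"
  using us
proof (induction us)
  case Nil
  show ?case by (intro exI[of _ "{}"] exI[of _ "[]"]) simp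
next
  case (Cons u us)
  then obtain S cs where S: "finite S" "S \<subseteq> pts X" "set cs \<subseteq> fin_gen X S"
    "list_all2 (\<lambda>c u. dst (TO X) c u < \<delta>) cs us" by auto
  obtain S' c where S': "finite S'" "S' \<subseteq> pts X" "c \<in> fin_gen X S'" "dst (TO X) c u < \<delta>"
    using fin_gen_dense[OF X _ \<delta>, of u] Cons.prems by auto
  have "fin_gen X S \<subseteq> fin_gen X (S \<union> S')" "fin_gen X S' \<subseteq> fin_gen X (S \<union> S')"
    using S S' by (intro fin_gen_mono[OF X]; simp)+
  then show ?case
    using S S' by (intro exI[of _ "S \<union> S'"] exI[of _ "c # cs"]) auto
qed

text \<open>Listing the common support S turns it into a standard space, so that one map
  \<open>g\<close> serves all the entries and the approximants are images of symbols of a single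
  arity.\<close>

lemma finite_approximation:
  assumes X: "X \<in> \<K>" and us: "set us \<subseteq> pts (TO X)" and \<delta>: "\<delta> > 0"
  obtains n g ts where "g \<in> hom (Nn n) X" "set ts \<subseteq> sig n"
    "list_all2 (\<lambda>t u. dst (TO X) (TA (Nn n) X g t) u < \<delta>) ts us"
proof -
  obtain S cs where S: "finite S" "S \<subseteq> pts X" and cs: "set cs \<subseteq> fin_gen X S"
    and close: "list_all2 (\<lambda>c u. dst (TO X) c u < \<delta>) cs us"
    using fin_gen_dense_list[OF assms] by blast
  let ?N = "disc S"
  have N: "?N \<in> Set_f" by (rule disc_in_Set_f[OF S(1)])
  let ?n = "size_of ?N"
  define g where "g = compose (pts (Nn ?n)) (incl S) (tuple (enum ?N))"
  have g: "g \<in> hom (Nn ?n) X"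
    unfolding g_def by (rule compose_hom[OF enum_hom[OF N] incl_hom[OF X S]])
  have "\<exists>t\<in>sig ?n. c = TA (Nn ?n) X g t" if c: "c \<in> fin_gen X S" for c
  proof -
    obtain s where s: "s \<in> pts (TO ?N)" "c = TA ?N X (incl S) s"
      using c by (auto simp: fin_gen_def)
    let ?t = "TA ?N (Nn ?n) (index ?N) s"
    have t: "?t \<in> sig ?n" by (rule TA_index_sig[OF N s(1)])
    have "TA (Nn ?n) X g ?t = TA ?N X (incl S) (TA (Nn ?n) ?N (tuple (enum ?N)) ?t)"
      unfolding g_def
      by (rule TA_TA[symmetric, OF Nn_in Set_f_in[OF N] X enum_hom[OF N] incl_hom[OF X S]
            t[unfolded sig_def]])
    then show ?thesis
      using t s(2) TA_enum_index[OF N s(1)] by (intro bexI[OF _ t]) simp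
  qed
  then obtain r where r: "\<And>c. c \<in> fin_gen X S \<Longrightarrow> r c \<in> sig ?n \<and> c = TA (Nn ?n) X g (r c)"
    by metis
  show ?thesis
  proof (rule that[OF g, of "map r cs"])
    show "set (map r cs) \<subseteq> sig ?n" using r cs by auto
    show "list_all2 (\<lambda>t u. dst (TO X) (TA (Nn ?n) X g t) u < \<delta>) (map r cs) us"
      unfolding list_all2_map1
    proof (rule list.rel_mono_strong[OF close])
    qed (use r cs in auto)
  qed
qed


section \<open>Universal property\<close>

text \<open>The three cocone conditions come from \<open>act_dst_symbols\<close> (nonexpanding in
  the element of T N), \<open>act_dst_args\<close> (nonexpanding in g) and
  \<open>act_natural\<close>.\<close>

lemma act_cocone:
  assumes A: "A \<in> \<V>" and X: "X \<in> \<K>" and f: "f \<in> hom X (under A)"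
  shows "weighted_cocone Set_f (functor_of T) X (under A)
    (\<lambda>N g. restrict (act A N (\<lambda>x. f (g x))) (pts (TO N)))"
  unfolding weighted_cocone_def
proof (intro conjI ballI)
  fix N g assume N: "N \<in> Set_f" and g: "g \<in> hom N X"
  have fg: "f (g x) \<in> pts (under A)" if "x \<in> pts N" for x
    using hom_mem[OF f] hom_mem[OF g] that by blast
  show "restrict (act A N (\<lambda>x. f (g x))) (pts (TO N)) \<in> hom (TO N) (under A)"
    using act_mem[OF A N fg] act_dst_symbols[OF A N fg] by (intro homI) auto
  fix k assume k: "k \<in> hom N X"
  have fk: "f (k x) \<in> pts (under A)" if "x \<in> pts N" for x
    using hom_mem[OF f] hom_mem[OF k] that by blast
  have "(SUP x\<in>pts N. dst (under A) (f (g x)) (f (k x))) \<le> hdist N X g k"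
    unfolding hdist_def
    by (intro SUP_mono bexI) (use hom_dst[OF f hom_mem[OF g] hom_mem[OF k]] in auto)
  then show "hdist (TO N) (under A) (restrict (act A N (\<lambda>x. f (g x))) (pts (TO N)))
      (restrict (act A N (\<lambda>x. f (k x))) (pts (TO N))) \<le> hdist N X g k"
    unfolding hdist_def[of "TO N"]
    using order_trans[OF act_dst_args[OF A N fg fk]] by (intro SUP_least) auto
next
  fix M N h g assume M: "M \<in> Set_f" and N: "N \<in> Set_f" and h: "h \<in> hom M N" and g: "g \<in> hom N X"
  have fg: "f (g x) \<in> pts (under A)" if "x \<in> pts N" for x
    using hom_mem[OF f] hom_mem[OF g] that by blast
  show "restrict (act A M (\<lambda>x. f (compose (pts M) g h x))) (pts (TO M)) =
      compose (pts (TO M)) (restrict (act A N (\<lambda>x. f (g x))) (pts (TO N))) (TA M N h)"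
  proof
    fix t
    have "act A M (\<lambda>x. f (compose (pts M) g h x)) t = act A M (\<lambda>x. f (g (h x))) t"
      unfolding act_def using set_enum[OF M]
      by (intro arg_cong[where f = "opn A _"] map_cong) (auto simp: compose_def)
    then show "restrict (act A M (\<lambda>x. f (compose (pts M) g h x))) (pts (TO M)) t =
        compose (pts (TO M)) (restrict (act A N (\<lambda>x. f (g x))) (pts (TO N))) (TA M N h) t"
      using act_natural[OF A M N h fg] hom_mem[OF TA_hom[OF Set_f_in[OF M] Set_f_in[OF N] h]]
      by (auto simp: compose_def)
  qed
qed

text \<open>A condition halfway between factorizing a cocone and being a homomorphism that extends
  f: it prescribes \<open>h\<close> on the elements coming from standard finite spaces.\<close>

definition extends :: "('u, 'u) algebra \<Rightarrow> 'u espace \<Rightarrow> ('u \<Rightarrow> 'u) \<Rightarrow> ('u \<Rightarrow> 'u) \<Rightarrow> bool" where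
  "extends A X f h \<longleftrightarrow> h \<in> hom (TO X) (under A) \<and>
     (\<forall>n. \<forall>g\<in>hom (Nn n) X. \<forall>t\<in>sig n. h (TA (Nn n) X g t) = opn A t (map (\<lambda>i. f (g (pt i))) [0..<n]))"

text \<open>The condition is equivalent to factorizing the cocone of \<open>act_cocone\<close>.
  Listings lead from standard spaces to arbitrary N, and \<open>act_Nn\<close> leads back; the Kan
  extension then gives existence and uniqueness.\<close>

lemma extends_ex1:
  assumes A: "A \<in> \<V>" and X: "X \<in> \<K>" and f: "f \<in> hom X (under A)"
  shows "\<exists>!h. extends A X f h"
proof -
  let ?\<alpha> = "\<lambda>N g. restrict (act A N (\<lambda>x. f (g x))) (pts (TO N))"
  have "extends A X f h \<longleftrightarrow> h \<in> hom (TO X) (under A) \<and>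
      (\<forall>N\<in>Set_f. \<forall>g\<in>hom N X. ?\<alpha> N g = compose (pts (TO N)) h (TA N X g))" for h
  proof
    assume h: "extends A X f h"
    have "act A N (\<lambda>x. f (g x)) t = h (TA N X g t)"
      if N: "N \<in> Set_f" and g: "g \<in> hom N X" and t: "t \<in> pts (TO N)" for N g t
    proof -
      let ?n = "size_of N"
      let ?g = "compose (pts (Nn ?n)) g (tuple (enum N))"
      let ?t = "TA N (Nn ?n) (index N) t"
      have g': "?g \<in> hom (Nn ?n) X" by (rule compose_hom[OF enum_hom[OF N] g])
      have t': "?t \<in> sig ?n" by (rule TA_index_sig[OF N t])
      have "TA N X g t = TA N X g (TA (Nn ?n) N (tuple (enum N)) ?t)"
        by (simp only: TA_enum_index[OF N t])
      also have "\<dots> = TA (Nn ?n) X ?g ?t"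
        by (rule TA_TA[OF Nn_in Set_f_in[OF N] X enum_hom[OF N] g t'[unfolded sig_def]])
      finally have "h (TA N X g t) = opn A ?t (map (\<lambda>i. f (?g (pt i))) [0..<?n])"
        using h g' t' by (simp add: extends_def)
      also have "map (\<lambda>i. f (?g (pt i))) [0..<?n] = map (\<lambda>x. f (g x)) (enum N)"
        by (rule nth_equalityI) (auto simp: compose_def tuple_pt)
      finally show ?thesis by (simp add: act_def)
    qed
    then show "h \<in> hom (TO X) (under A) \<and>
        (\<forall>N\<in>Set_f. \<forall>g\<in>hom N X. ?\<alpha> N g = compose (pts (TO N)) h (TA N X g))"
      using h by (auto simp: extends_def compose_def fun_eq_iff)
  next
    assume h: "h \<in> hom (TO X) (under A) \<and>
      (\<forall>N\<in>Set_f. \<forall>g\<in>hom N X. ?\<alpha> N g = compose (pts (TO N)) h (TA N X g))"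
    have "h (TA (Nn n) X g t) = opn A t (map (\<lambda>i. f (g (pt i))) [0..<n])"
      if g: "g \<in> hom (Nn n) X" and t: "t \<in> sig n" for n g t
    proof -
      have "?\<alpha> (Nn n) g t = compose (pts (TO (Nn n))) h (TA (Nn n) X g) t"
        using h g Nn_Set_f by metis
      then have "h (TA (Nn n) X g t) = act A (Nn n) (\<lambda>x. f (g x)) t"
        using t by (simp add: compose_def sig_def)
      also have "\<dots> = opn A t (map (\<lambda>i. f (g (pt i))) [0..<n])"
        using hom_mem[OF f hom_mem[OF g]] by (intro act_Nn[OF A _ t]) auto
      finally show ?thesis .
    qed
    with h show "extends A X f h" by (simp add: extends_def)
  qed
  then show ?thesis
    using Kan_factorization[OF X variety_in[OF A] act_cocone[OF A X f]] by simp
qed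

text \<open>A point x is a map from the standard one-point space, and the unit symbol of arity 1
  acts as the identity.\<close>

lemma extends_unit:
  assumes A: "A \<in> \<V>" and X: "X \<in> \<K>" and f: "f \<in> hom X (under A)" and h: "extends A X f h"
  shows "compose (pts X) h (unit X) = f"
proof (rule extensionalityI[OF compose_extensional hom_extensional[OF f]])
  fix x assume x: "x \<in> pts X"
  have g: "tuple [x] \<in> hom (Nn 1) X"
    by (rule tuple_hom[OF X]) (use x in auto)
  have u: "unit (Nn 1) (pt 0) \<in> sig 1"
    using hom_mem[OF unit_hom[OF Nn_in[of 1]]] by (simp add: sig_def)
  have t0: "tuple [x] (pt 0) = x" by (simp add: tuple_pt)
  have "TA (Nn 1) X (tuple [x]) (unit (Nn 1) (pt 0)) = unit X x"
    using fun_cong[OF TA_unit[OF Nn_in X g], of "pt 0"] t0 by (simp add: compose_def)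
  then have "h (unit X x) = opn A (unit (Nn 1) (pt 0)) (map (\<lambda>i. f (tuple [x] (pt i))) [0..<1])"
    using h g u unfolding extends_def by metis
  also have "\<dots> = f x"
    using opn_projection[OF A, of "[f x]" 1 0] hom_mem[OF f x] t0 by simp
  finally show "compose (pts X) h (unit X) x = f x"
    using x by (simp add: compose_def)
qed

text \<open>
  The homomorphism law holds on elements coming from one finite discrete space, by the
  substitution equations; density and nonexpansiveness of both sides give the general case.
\<close>

lemma extends_alg_hom:
  assumes A: "A \<in> \<V>" and X: "X \<in> \<K>" and f: "f \<in> hom X (under A)" and h: "extends A X f h"
  shows "h \<in> alg_hom sig (free X) A"
proof -
  note TX = TO_in[OF X] and AK = variety_in[OF A]
  note mX = ext_metricD[OF in_metric[OF TX]] and mA = ext_metricD[OF in_metric[OF AK]]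
  have hh: "h \<in> hom (TO X) (under A)" using h by (simp add: extends_def)
  have "h (opn (free X) \<sigma> us) = opn A \<sigma> (map h us)"
    if \<sigma>: "\<sigma> \<in> sig m" and us: "set us \<subseteq> pts (TO X)" "length us = m" for m \<sigma> us
  proof -
    have husA: "set (map h us) \<subseteq> pts (under A)"
      using us hom_mem[OF hh] by auto
    let ?l = "h (opn (free X) \<sigma> us)" and ?r = "opn A \<sigma> (map h us)"
    have l: "?l \<in> pts (under A)"
      by (rule hom_mem[OF hh opn_free_mem[OF X \<sigma> us]])
    have r: "?r \<in> pts (under A)"
      using us(2) by (intro opn_mem[OF A \<sigma> husA]) simp
    \<comment> \<open>The summand 0 matches the form of \<open>ennreal_le_epsilon\<close>, which
      later removes \<open>\<delta>\<close>.\<close>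
    have close: "dst (under A) ?l ?r \<le> 0 + \<delta>" if \<delta>: "0 < \<delta>" for \<delta>
    proof -
      obtain e where e: "e > 0" "e + e = \<delta>"
        using ennreal_half[OF \<delta>] .
      obtain n g ts where g: "g \<in> hom (Nn n) X" and ts: "set ts \<subseteq> sig n"
        and tu: "list_all2 (\<lambda>t u. dst (TO X) (TA (Nn n) X g t) u < e) ts us"
        using finite_approximation[OF X us(1) e(1)] .
      have len: "length ts = m" using tu us(2) by (simp add: list_all2_lengthD)
      let ?vs = "map (TA (Nn n) X g) ts"
      have vs: "set ?vs \<subseteq> pts (TO X)"
        using ts hom_mem[OF TA_hom[OF Nn_in X g]] by (auto simp: sig_def)
      have hvsA: "set (map h ?vs) \<subseteq> pts (under A)"
        using vs hom_mem[OF hh] by auto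
      have near: "dst (TO X) (?vs ! i) (us ! i) \<le> e" if "i < m" for i
        using list_all2_nthD[OF tu, of i] that len by simp
      let ?as = "map (\<lambda>i. f (g (pt i))) [0..<n]"
      have as: "set ?as \<subseteq> pts (under A)" using hom_mem[OF f hom_mem[OF g]] by auto
      have \<tau>: "opn (free (Nn n)) \<sigma> ts \<in> sig n"
        using opn_free_mem[OF Nn_in \<sigma> _ len, of n] ts by (simp add: sig_def)
      \<comment> \<open>On the approximants \<open>?vs\<close> the homomorphism law is exact,
        because they all come from T n along the same \<open>g\<close>.\<close>
      have "h (opn (free X) \<sigma> ?vs) = h (TA (Nn n) X g (opn (free (Nn n)) \<sigma> ts))"
        using TA_opn_free[OF Nn_in X g \<sigma> _ len] ts by (simp add: sig_def)
      also have "\<dots> = opn A (opn (free (Nn n)) \<sigma> ts) ?as"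
        using h g \<tau> by (simp add: extends_def)
      also have "\<dots> = opn A \<sigma> (map (\<lambda>t. opn A t ?as) ts)"
        by (rule opn_substitution[OF A \<sigma> ts len as]) simp
      also have "map (\<lambda>t. opn A t ?as) ts = map h ?vs"
        using h g ts by (auto simp: extends_def)
      finally have eq: "h (opn (free X) \<sigma> ?vs) = opn A \<sigma> (map h ?vs)" .
      have v: "h (opn (free X) \<sigma> ?vs) \<in> pts (under A)"
        using len by (intro hom_mem[OF hh opn_free_mem[OF X \<sigma> vs]]) simp
      \<comment> \<open>Passing from \<open>?vs\<close> to \<open>us\<close> changes each side of
        the law by at most \<open>e\<close>, since \<open>h\<close> and the operations are
        nonexpanding.\<close>
      have "dst (under A) (h (opn (free X) \<sigma> ?vs)) ?l \<le> dst (TO X) (opn (free X) \<sigma> ?vs) (opn (free X) \<sigma> us)"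
        using len us by (intro hom_dst[OF hh] opn_free_mem[OF X \<sigma>] vs) simp_all
      also have "\<dots> \<le> (SUP i\<in>{..<m}. dst (TO X) (?vs ! i) (us ! i))"
        using len us by (intro opn_free_dst_args[OF X \<sigma> vs _ us]) simp
      also have "\<dots> \<le> e"
        using near by (intro SUP_least) simp
      finally have 1: "dst (under A) ?l (h (opn (free X) \<sigma> ?vs)) \<le> e"
        using mA(3)[OF l v] by simp
      have "dst (under A) (h (opn (free X) \<sigma> ?vs)) ?r \<le>
          (SUP i\<in>{..<m}. dst (under A) (map h ?vs ! i) (map h us ! i))"
        unfolding eq using len us(2) by (intro opn_dst_args[OF A \<sigma> hvsA _ husA]) simp_all
      also have "\<dots> \<le> e"
      proof (rule SUP_least)
        fix i assume "i \<in> {..<m}"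
        then have i: "i < m" by simp
        then have "?vs ! i \<in> pts (TO X)" "us ! i \<in> pts (TO X)"
          using vs us len nth_mem[of i ?vs] nth_mem[of i us] by auto
        from order_trans[OF hom_dst[OF hh this] near[OF i]]
        show "dst (under A) (map h ?vs ! i) (map h us ! i) \<le> e"
          using i len us(2) by simp
      qed
      finally have 2: "dst (under A) (h (opn (free X) \<sigma> ?vs)) ?r \<le> e" .
      show ?thesis
        using order_trans[OF mA(4)[OF l v r] add_mono[OF 1 2]] e(2) by simp
    qed
    have "dst (under A) ?l ?r \<le> 0"
      by (rule ennreal_le_epsilon, rule close) simp
    then show ?thesis
      using mA(2)[OF l r] by simp
  qed
  then show ?thesis
    using hh by (auto simp: alg_hom_def in_lists_conv_set subset_iff)
qed

section \<open>Freeness of T X and the induced monad\<close>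

lemma alg_hom_opn:
  "h \<in> alg_hom sig F A \<Longrightarrow> \<sigma> \<in> sig n \<Longrightarrow> set xs \<subseteq> pts (under F) \<Longrightarrow> length xs = n \<Longrightarrow>
     h (opn F \<sigma> xs) = opn A \<sigma> (map h xs)"
  by (auto simp: alg_hom_def in_lists_conv_set subset_iff)

text \<open>By \<open>opn_free_unit\<close>, T g t is the operation t at generators;
  \<open>h\<close> preserves the operation and has prescribed values on the generators.\<close>

lemma alg_hom_extends:
  assumes X: "X \<in> \<K>" and h: "h \<in> alg_hom sig (free X) A" and u: "compose (pts X) h (unit X) = f"
  shows "extends A X f h"
  unfolding extends_def
proof (intro conjI allI ballI)
  show "h \<in> hom (TO X) (under A)" using h by (simp add: alg_hom_def)
  fix n g t assume g: "g \<in> hom (Nn n) X" and t: "t \<in> sig n"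
  have gX: "g (pt i) \<in> pts X" if "i < n" for i
    using hom_mem[OF g] that by simp
  let ?us = "map (\<lambda>i. unit X (g (pt i))) [0..<n]"
  have us: "set ?us \<subseteq> pts (TO X)" using hom_mem[OF unit_hom[OF X]] gX by auto
  have "h (TA (Nn n) X g t) = h (opn (free X) t ?us)"
    by (simp only: opn_free_unit[OF X g t])
  also have "\<dots> = opn A t (map h ?us)"
    using us by (intro alg_hom_opn[OF h t]) simp_all
  also have "map h ?us = map (\<lambda>i. f (g (pt i))) [0..<n]"
    using gX u by (auto simp: compose_def)
  finally show "h (TA (Nn n) X g t) = opn A t (map (\<lambda>i. f (g (pt i))) [0..<n])" .
qed

lemma free_is_free_algebra:
  assumes X: "X \<in> \<K>"
  shows "is_free_algebra sig \<V> X (free X) (unit X)"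
  unfolding is_free_algebra_def
proof (intro conjI ballI)
  show "free X \<in> \<V>" by (rule free_in_variety[OF X])
  show "unit X \<in> hom X (under (free X))" using unit_hom[OF X] by simp
  fix A f assume A: "A \<in> \<V>" and f: "f \<in> hom X (under A)"
  have "h \<in> alg_hom sig (free X) A \<and> compose (pts X) h (unit X) = f \<longleftrightarrow> extends A X f h" for h
    using extends_alg_hom[OF A X f] extends_unit[OF A X f] alg_hom_extends[OF X] by blast
  then show "\<exists>!h. h \<in> alg_hom sig (free X) A \<and> compose (pts X) h (unit X) = f"
    using extends_ex1[OF A X f] by simp
qed

text \<open>The left adjoint is X \<mapsto> \<open>free X\<close>. Both T f and the multiplication
  preserve operations, so the free-algebra monad for this choice is T itself.\<close>

lemma is_free_algebra_monad: "is_free_algebra_monad \<K> sig \<V> T"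
  unfolding is_free_algebra_monad_def
proof (intro exI[of _ free] conjI ballI)
  fix X assume X: "X \<in> \<K>"
  show "is_free_algebra sig \<V> X (free X) (unit X)" by (rule free_is_free_algebra[OF X])
  show "TO X = under (free X)" by simp
  have "mult X \<in> alg_hom sig (free (TO X)) (free X)"
    using mult_hom[OF X] mult_opn_free[OF X]
    by (auto simp: alg_hom_def in_lists_conv_set subset_iff)
  then show "let TX = under (free X) in mult X \<in> alg_hom sig (free TX) (free X) \<and>
      compose (pts TX) (mult X) (unit TX) = ident TX"
    using monad_laws[OF X] by simp
  fix Y f assume Y: "Y \<in> \<K>" and f: "f \<in> hom X Y"
  show "TA X Y f \<in> alg_hom sig (free X) (free Y)"
    using TA_hom[OF X Y f] TA_opn_free[OF X Y f]
    by (auto simp: alg_hom_def in_lists_conv_set subset_iff)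
  show "compose (pts X) (TA X Y f) (unit X) = compose (pts X) (unit Y) f"
    by (rule TA_unit[OF X Y f])
qed

lemma sig_small: "sig n \<in> \<U>"
  unfolding sig_def by (rule in_universe[OF TO_in[OF Nn_in]])

lemma monads_isomorphic_refl: "monads_isomorphic \<K> T T"
  unfolding monads_isomorphic_def
proof (intro exI[of _ "\<lambda>X. ident (TO X)"] conjI ballI)
  have "compose (pts (TO X)) (ident (TO Y)) (TA X Y f) = compose (pts (TO X)) (TA X Y f) (ident (TO X))"
    if "X \<in> \<K>" "Y \<in> \<K>" "f \<in> hom X Y" for X Y f
    using hom_mem[OF TA_hom[OF that]] by (auto simp: compose_def ident_def fun_eq_iff)
  then show "nat_trans \<K> (functor_of T) (functor_of T) (\<lambda>X. ident (TO X))"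
    unfolding nat_trans_def using ident_hom by blast
  fix X assume X: "X \<in> \<K>"
  note TX = TO_in[OF X]
  have "iso_hom (TO X) (TO X) (ident (TO X))"
    unfolding iso_hom_def using ident_hom compose_ident[OF ident_hom] by blast
  moreover have "compose (pts X) (ident (TO X)) (unit X) = unit X"
    by (rule compose_ident[OF unit_hom[OF X]])
  moreover have "compose (pts (TO (TO X))) (ident (TO X)) (mult X) = mult X"
    by (rule compose_ident[OF mult_hom[OF X]])
  moreover have "compose (pts (TO (TO X))) (mult X) (ident (TO (TO X))) = mult X"
    using hom_extensional[OF mult_hom[OF X]]
    by (auto simp: compose_def ident_def fun_eq_iff extensional_def)
  ultimately show "let SX = TO X; TX = TO X; SSX = TO SX in
      iso_hom SX TX (ident (TO X)) \<and> compose (pts X) (ident (TO X)) (unit X) = unit X \<and>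
      compose (pts SSX) (ident (TO X)) (mult X) =
        compose (pts SSX) (mult X) (compose (pts SSX) (ident (TO TX)) (TA SX TX (ident (TO X))))"
    by (simp add: Let_def TA_ident[OF TX] compose_ident[OF ident_hom])
qed

end

theorem theorem3p21:
  fixes \<U> :: "'u set set" and \<K> :: "'u espace set" and T :: "'u monad"
  assumes "set_universe \<U>"
    and "\<K> = Met \<U> \<or> \<K> = CMet \<U>"
    and "strongly_finitary_monad \<K> T"
  shows "\<exists>(\<Sigma> :: 'u signature) (E :: 'u quantitative_equation set) (M :: 'u monad).
           (\<forall>n. \<Sigma> n \<in> \<U>) \<and> (\<forall>e\<in>E. equation_over \<Sigma> e) \<and>
           is_free_algebra_monad \<K> \<Sigma> (variety \<K> \<Sigma> E) M \<and>
           monads_isomorphic \<K> T M"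
proof -
  \<comment> \<open>The universe type is infinite, so it contains a copy of the natural
    numbers.\<close>
  obtain pt :: "nat \<Rightarrow> 'u" where "inj pt"
    using assms(1) infinite_countable_subset[of "UNIV :: 'u set"] by (auto simp: set_universe_def)
  then interpret space_monad \<U> \<K> T pt
    using assms by unfold_locales
  \<comment> \<open>The free-algebra monad can be chosen equal to T, so the identity transformation
    is the required isomorphism.\<close>
  show ?thesis
    using sig_small is_free_algebra_monad monads_isomorphic_refl
    by (intro exI[of _ sig] exI[of _ eqs] exI[of _ T]) (auto simp: eqs_def)
qed

end
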